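(* Let $\mathcal S$ be a simple bundle of circles in $\mathbb{R}^4$ whose set of tangent directions at $0$ is Zariski dense, and suppose $\mathcal S$ is rectifiable. Then there exist affine maps $A,B:\mathbb{R}^4\to\mathbb{R}^4$ such that the map $T$ given either by $T(x)=B(x)^{-1}A(x)$ or by $T(x)=A(x)B(x)^{-1}$ satisfies $T(0)=0$, is a local diffeomorphism at $0$, and $T^{-1}$ maps the germ at $0$ of every circle of $\mathcal S$ into a straight line.
   Context: A *circle* in $\mathbb{R}^4$ means either a round Euclidean circle or a straight line. A *simple bundle of circles* is a collection of circles all passing through $0$, no two tangent at $0$; it is *rectifiable* if some germ at $0$ of a smooth diffeomorphism $(\mathbb{R}^4,0)\to(\mathbb{R}^4,0)$ maps the germ at $0$ of every circle of the collection into a straight line. A set $\mathcal D$ of lines through $0$ in $\mathbb{R}^4$ is *Zariski dense* if every homogeneous real polynomial on $\mathbb{R}^4$ vanishing on all lines of $\mathcal D$ is identically zero. $\mathbb{R}^4$ is identified with the quaternions $\mathbb{H}$ by sending an orthonormal basis to $1,i,j,k$; products and inverses are quaternionic. *)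

theory Defs
  imports "HOL-Analysis.Analysis"
begin

(* R^4 = real^4, standard basis e1,e2,e3,e4 identified with quaternions 1,i,j,k *)

definition qmult :: "real^4 \<Rightarrow> real^4 \<Rightarrow> real^4" where
  "qmult p q = vector
     [p$1*q$1 - p$2*q$2 - p$3*q$3 - p$4*q$4,
      p$1*q$2 + p$2*q$1 + p$3*q$4 - p$4*q$3,
      p$1*q$3 - p$2*q$4 + p$3*q$1 + p$4*q$2,
      p$1*q$4 + p$2*q$3 - p$3*q$2 + p$4*q$1]"

definition qconj :: "real^4 \<Rightarrow> real^4" where
  "qconj q = vector [q$1, - q$2, - q$3, - q$4]"

(* quaternionic inverse; by the HOL convention 1/0 = 0 it sends 0 to 0 *)
definition qinv :: "real^4 \<Rightarrow> real^4" where
  "qinv q = (1 / (norm q)\<^sup>2) *\<^sub>R qconj q"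

definition affine_map :: "(real^4 \<Rightarrow> real^4) \<Rightarrow> bool" where
  "affine_map A \<longleftrightarrow> (\<exists>L b. linear L \<and> A = (\<lambda>x. L x + b))"

fun Ck :: "nat \<Rightarrow> 'a::euclidean_space set \<Rightarrow> ('a \<Rightarrow> 'b::euclidean_space) \<Rightarrow> bool" where
  "Ck 0 U f = continuous_on U f"
| "Ck (Suc k) U f = (\<exists>D. (\<forall>x\<in>U. (f has_derivative D x) (at x)) \<and>
                         (\<forall>v\<in>Basis. Ck k U (\<lambda>x. D x v)))"

definition smooth_on :: "'a::euclidean_space set \<Rightarrow> ('a \<Rightarrow> 'b::euclidean_space) \<Rightarrow> bool" where
  "smooth_on U f \<longleftrightarrow> (\<forall>k. Ck k U f)"

definition diffeo_on :: "(real^4) set \<Rightarrow> (real^4) set \<Rightarrow> (real^4 \<Rightarrow> real^4) \<Rightarrow> (real^4 \<Rightarrow> real^4) \<Rightarrow> bool" where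
  "diffeo_on U V f g \<longleftrightarrow> open U \<and> open V \<and> f ` U = V \<and> g ` V = U \<and>
     (\<forall>x\<in>U. g (f x) = x) \<and> (\<forall>y\<in>V. f (g y) = y) \<and> smooth_on U f \<and> smooth_on V g"

definition circle_param :: "real^4 \<Rightarrow> real \<Rightarrow> real^4 \<Rightarrow> real^4 \<Rightarrow> real \<Rightarrow> real^4" where
  "circle_param c r u v t = c + r *\<^sub>R (cos t *\<^sub>R u + sin t *\<^sub>R v)"

definition line_param :: "real^4 \<Rightarrow> real^4 \<Rightarrow> real \<Rightarrow> real^4" where
  "line_param p d t = p + t *\<^sub>R d"

definition circle_curve :: "(real \<Rightarrow> real^4) \<Rightarrow> bool" where
  "circle_curve \<gamma> \<longleftrightarrow>
     (\<exists>c r u v. r > 0 \<and> norm u = 1 \<and> norm v = 1 \<and> inner u v = 0 \<and> \<gamma> = circle_param c r u v)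
   \<or> (\<exists>p d. d \<noteq> 0 \<and> \<gamma> = line_param p d)"

definition is_circle :: "(real^4) set \<Rightarrow> bool" where
  "is_circle C \<longleftrightarrow> (\<exists>\<gamma>. circle_curve \<gamma> \<and> C = range \<gamma>)"

definition is_line :: "(real^4) set \<Rightarrow> bool" where
  "is_line L \<longleftrightarrow> (\<exists>p d. d \<noteq> 0 \<and> L = range (line_param p d))"

definition tangent_line0 :: "(real^4) set \<Rightarrow> (real^4) set \<Rightarrow> bool" where
  "tangent_line0 C L \<longleftrightarrow> (\<exists>\<gamma> t0 w. circle_curve \<gamma> \<and> C = range \<gamma> \<and> \<gamma> t0 = 0 \<and>
      (\<gamma> has_vector_derivative w) (at t0) \<and> L = span {w})"

definition simple_bundle :: "(real^4) set set \<Rightarrow> bool" where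
  "simple_bundle S \<longleftrightarrow> (\<forall>C\<in>S. is_circle C \<and> 0 \<in> C) \<and>
     (\<forall>C1\<in>S. \<forall>C2\<in>S. C1 \<noteq> C2 \<longrightarrow> \<not> (\<exists>L. tangent_line0 C1 L \<and> tangent_line0 C2 L))"

definition tangent_dirs :: "(real^4) set set \<Rightarrow> (real^4) set set" where
  "tangent_dirs S = {L. \<exists>C\<in>S. tangent_line0 C L}"

definition hpoly :: "nat \<Rightarrow> ((4 \<Rightarrow> nat) \<Rightarrow> real) \<Rightarrow> real^4 \<Rightarrow> real" where
  "hpoly d c x = (\<Sum>\<alpha>\<in>{\<alpha>::4 \<Rightarrow> nat. sum \<alpha> UNIV = d}. c \<alpha> * (\<Prod>i\<in>UNIV. (x$i) ^ \<alpha> i))"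

definition zariski_dense :: "(real^4) set set \<Rightarrow> bool" where
  "zariski_dense D \<longleftrightarrow> (\<forall>d c. (\<forall>L\<in>D. \<forall>x\<in>L. hpoly d c x = 0) \<longrightarrow>
        (\<forall>\<alpha>::4 \<Rightarrow> nat. sum \<alpha> UNIV = d \<longrightarrow> c \<alpha> = 0))"

definition rectifiable :: "(real^4) set set \<Rightarrow> bool" where
  "rectifiable S \<longleftrightarrow> (\<exists>\<phi> \<psi> U V. 0 \<in> U \<and> diffeo_on U V \<phi> \<psi> \<and> \<phi> 0 = 0 \<and>
     (\<forall>C\<in>S. \<exists>L \<epsilon>. is_line L \<and> \<epsilon> > 0 \<and> ball 0 \<epsilon> \<subseteq> U \<and> \<phi> ` (C \<inter> ball 0 \<epsilon>) \<subseteq> L))"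

end

theory Submission
  imports Defs
begin

text \<open>Let \<open>\<psi>\<close> be the inverse of a rectifying diffeomorphism \<open>\<phi>\<close>, and \<open>A\<close> the derivative of \<open>\<phi>\<close> at \<open>0\<close>, so that
  \<open>\<psi>(t A x) = t x + t\<^sup>2 Q(x) + t\<^sup>3 K(x) + t\<^sup>4 M(x) + o(t\<^sup>4)\<close> with homogeneous polynomial maps \<open>Q\<close>, \<open>K\<close>, \<open>M\<close>. For a
  tangent direction \<open>x\<close> this curve lies on a circle \<open>p = |p|\<^sup>2 m + s x\<close>; comparing coefficients and eliminating \<open>m\<close> gives
  \<open>|x|\<^sup>2 K \<and> x = 2 (x \<bullet> Q) Q \<and> x\<close> and \<open>|x|\<^sup>2 M \<and> x = (|Q|\<^sup>2 + 2 x \<bullet> K) Q \<and> x\<close>, and Zariski density extends both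
  identities to all \<open>x\<close>. As \<open>|x|\<^sup>2\<close> is a prime polynomial, it divides \<open>x \<bullet> Q\<close> and \<open>|Q|\<^sup>2\<close>: on the complex null cone,
  \<open>x\<close> and \<open>Q(x)\<close> span an isotropic space. The two families of isotropic planes of the quaternions give
  \<open>Q(x) = \<beta>(x) x\<close> or \<open>Q(x) = x \<beta>(x)\<close> with \<open>\<beta>\<close> linear. Then \<open>T(x) = (1 - \<beta>(x))\<^sup>-\<^sup>1 x\<close>, respectively
  \<open>x (1 - \<beta>(x))\<^sup>-\<^sup>1\<close>, maps each line through \<open>0\<close> into the circle
  with the prescribed velocity and normal acceleration at \<open>0\<close>, and these determine the circle.\<close>

section \<open>Homogeneous polynomials and divisibility by the quadratic form\<close>

text \<open>Hiding the coefficient family lets polynomials be assembled by closure rules, while they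
  remain of the form \<open>hpoly\<close> in which \<open>zariski_dense\<close> is stated. The zero
  polynomial has every degree.\<close>

definition hom_poly :: "nat \<Rightarrow> (real^4 \<Rightarrow> real) \<Rightarrow> bool" where
  "hom_poly d f \<longleftrightarrow> (\<exists>c. f = hpoly d c)"

lemma finite_multiindices: "finite {\<alpha>::4 \<Rightarrow> nat. sum \<alpha> UNIV = d}"
proof -
  have "{\<alpha>::4 \<Rightarrow> nat. sum \<alpha> UNIV = d} \<subseteq> (\<Pi>\<^sub>E i\<in>UNIV. {..d})"
    by (auto simp: PiE_def Pi_def extensional_def intro!: member_le_sum)
  then show ?thesis
    by (rule finite_subset) (auto intro: finite_PiE)
qed

lemma hom_poly_add: "hom_poly d f \<Longrightarrow> hom_poly d g \<Longrightarrow> hom_poly d (\<lambda>x. f x + g x)"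
  unfolding hom_poly_def hpoly_def
  by (force simp: distrib_right sum.distrib fun_eq_iff intro: exI[of _ "\<lambda>\<alpha>. _ \<alpha> + _ \<alpha>"])

lemma hom_poly_scale: "hom_poly d f \<Longrightarrow> hom_poly d (\<lambda>x. a * f x)"
  unfolding hom_poly_def hpoly_def
  by (force simp: sum_distrib_left mult.assoc fun_eq_iff intro: exI[of _ "\<lambda>\<alpha>. a * _ \<alpha>"])

lemma hom_poly_monomial:
  assumes "sum \<alpha> UNIV = d"
  shows "hom_poly d (\<lambda>x. \<Prod>i\<in>UNIV. (x$i) ^ \<alpha> i)"
  unfolding hom_poly_def hpoly_def
proof (rule exI[of _ "\<lambda>\<beta>. if \<beta> = \<alpha> then 1 else 0"], rule ext)
  fix x :: "real^4"
  show "(\<Prod>i\<in>UNIV. (x$i) ^ \<alpha> i) = (\<Sum>\<beta> | sum \<beta> UNIV = d. (if \<beta> = \<alpha> then 1 else 0) * (\<Prod>i\<in>UNIV. (x$i) ^ \<beta> i))"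
    using sum.delta[OF finite_multiindices[of d], of \<alpha> "\<lambda>\<beta>. \<Prod>i\<in>UNIV. (x$i) ^ \<beta> i"] assms
    by (simp add: if_distrib[of "\<lambda>u. u * _"] cong: if_cong)
qed

lemma hom_poly_zero: "hom_poly d (\<lambda>x. 0)"
  unfolding hom_poly_def hpoly_def by (auto intro!: exI[of _ "\<lambda>_. 0"])

lemma hom_poly_sum: "(\<And>i. i \<in> I \<Longrightarrow> hom_poly d (f i)) \<Longrightarrow> hom_poly d (\<lambda>x. \<Sum>i\<in>I. f i x)"
proof (induction I rule: infinite_finite_induct)
  case (insert i I)
  then show ?case by (simp add: hom_poly_add)
qed (simp_all add: hom_poly_zero)

lemma hom_poly_diff: "hom_poly d f \<Longrightarrow> hom_poly d g \<Longrightarrow> hom_poly d (\<lambda>x. f x - g x)"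
  using hom_poly_add[of d f "\<lambda>x. -1 * g x"] hom_poly_scale[of d g "-1"] by simp

lemma hom_poly_mult:
  assumes "hom_poly d f" "hom_poly e g"
  shows "hom_poly (d + e) (\<lambda>x. f x * g x)"
proof -
  obtain a b where f: "f = hpoly d a" and g: "g = hpoly e b"
    using assms by (auto simp: hom_poly_def)
  have *: "f x * g x = (\<Sum>\<alpha> | sum \<alpha> UNIV = d. \<Sum>\<beta> | sum \<beta> UNIV = e.
       (a \<alpha> * b \<beta>) * (\<Prod>i\<in>UNIV. (x$i) ^ (\<alpha> i + \<beta> i)))" for x
    unfolding f g hpoly_def
    by (simp add: sum_product power_add prod.distrib mult_ac)
  show ?thesis
    unfolding *
    by (intro hom_poly_sum hom_poly_scale hom_poly_monomial) (auto simp: sum.distrib)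
qed

lemma hom_poly_const: "hom_poly 0 (\<lambda>x. c)"
  using hom_poly_scale[OF hom_poly_monomial[of "\<lambda>_. 0" 0], of c] by simp

lemma hom_poly_nth: "hom_poly 1 (\<lambda>x. x $ i)"
proof -
  have "(\<Prod>j\<in>UNIV. (x$j) ^ (if j = i then 1 else 0)) = x $ i" for x :: "real^4"
    by (simp add: if_distrib[of "\<lambda>u. _ ^ u"] cong: if_cong)
  then show ?thesis
    using hom_poly_monomial[of "\<lambda>j. if j = i then 1 else 0" 1] by simp
qed

lemma hom_poly_linear:
  assumes "linear A"
  shows "hom_poly 1 (\<lambda>x. A x $ i)"
proof -
  have "A x $ i = (\<Sum>j\<in>UNIV. A (axis j 1) $ i * x $ j)" for x
  proof -
    have "A x = A (\<Sum>j\<in>UNIV. x $ j *\<^sub>R axis j 1)"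
      using basis_expansion[of x] by (simp add: scalar_mult_eq_scaleR)
    also have "\<dots> = (\<Sum>j\<in>UNIV. x $ j *\<^sub>R A (axis j 1))"
      by (simp add: linear_sum[OF assms] linear_cmul[OF assms])
    finally show ?thesis by (simp add: mult.commute)
  qed
  then have "(\<lambda>x. A x $ i) = (\<lambda>x. \<Sum>j\<in>UNIV. A (axis j 1) $ i * x $ j)" by (rule ext)
  moreover have "hom_poly 1 (\<lambda>x. \<Sum>j\<in>UNIV. A (axis j 1) $ i * x $ j)"
    by (intro hom_poly_sum hom_poly_scale hom_poly_nth)
  ultimately show ?thesis by metis
qed

lemma hom_poly_homogeneous:
  assumes "hom_poly d f"
  shows "f (t *\<^sub>R x) = t ^ d * f x"
proof -
  obtain c where f: "f = hpoly d c" using assms by (auto simp: hom_poly_def)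
  have "(\<Prod>i\<in>UNIV. (t * x$i) ^ \<alpha> i) = t ^ d * (\<Prod>i\<in>UNIV. (x$i) ^ \<alpha> i)"
    if "sum \<alpha> UNIV = d" for \<alpha> :: "4 \<Rightarrow> nat"
    using that by (simp add: power_mult_distrib prod.distrib flip: power_sum)
  then show ?thesis
    unfolding f hpoly_def by (simp add: sum_distrib_left mult_ac)
qed

section \<open>Polynomial functions without a fixed degree\<close>

lemma real_polynomial_function_add:
  "real_polynomial_function f \<Longrightarrow> real_polynomial_function g \<Longrightarrow> real_polynomial_function (\<lambda>x. f x + g x)"
  and real_polynomial_function_mult:
  "real_polynomial_function f \<Longrightarrow> real_polynomial_function g \<Longrightarrow> real_polynomial_function (\<lambda>x. f x * g x)"
  and real_polynomial_function_const: "real_polynomial_function (\<lambda>x. c)"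
  by auto

lemma real_polynomial_function_nth: "real_polynomial_function (\<lambda>x::real^'n. x $ i)"
  by (auto intro: bounded_linear_vec_nth)

lemma hom_poly_imp_real_polynomial_function:
  assumes "hom_poly d f"
  shows "real_polynomial_function f"
proof -
  obtain c where f: "f = hpoly d c" using assms by (auto simp: hom_poly_def)
  show ?thesis
    unfolding f hpoly_def
    by (intro real_polynomial_function_sum finite_multiindices real_polynomial_function_mult
        real_polynomial_function_const real_polynomial_function_prod real_polynomial_function_power
        real_polynomial_function_nth) simp
qed

lemma zariski_dense_hom_poly_zero:
  assumes "zariski_dense D" "hom_poly d f" "\<And>L x. L \<in> D \<Longrightarrow> x \<in> L \<Longrightarrow> f x = 0"
  shows "f x = 0"
proof -
  obtain c where f: "f = hpoly d c" using assms(2) by (auto simp: hom_poly_def)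
  have "\<forall>L\<in>D. \<forall>x\<in>L. hpoly d c x = 0"
    using assms(3) f by blast
  then have "\<forall>\<alpha>::4 \<Rightarrow> nat. sum \<alpha> UNIV = d \<longrightarrow> c \<alpha> = 0"
    using assms(1) unfolding zariski_dense_def by blast
  then show ?thesis unfolding f hpoly_def by simp
qed

text \<open>A polynomial is differentiable at 0, and homogeneity of degree one makes it agree on
  every ray with its derivative there.\<close>

lemma real_polynomial_function_homogeneous_imp_linear:
  fixes f :: "'a::real_normed_vector \<Rightarrow> real"
  assumes "real_polynomial_function f" "\<And>t x. f (t *\<^sub>R x) = t * f x"
  shows "linear f"
proof -
  have "\<exists>D. (f has_derivative D) (at 0)"
    using assms(1)
  proof induction
    case (linear f)
    then show ?case by (blast intro: bounded_linear_imp_has_derivative)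
  qed (blast intro: derivative_intros)+
  then obtain D where D: "(f has_derivative D) (at 0)" by blast
  interpret D: bounded_linear D by (rule has_derivative_bounded_linear[OF D])
  have "f x = D x" for x
  proof -
    have "((\<lambda>t. t *\<^sub>R x) has_derivative (\<lambda>t. t *\<^sub>R x)) (at 0)"
      by (auto intro!: derivative_eq_intros)
    moreover have "(f has_derivative D) (at (0 *\<^sub>R x))" using D by simp
    ultimately have "((\<lambda>t. f (t *\<^sub>R x)) has_derivative (\<lambda>t. D (t *\<^sub>R x))) (at 0)"
      using has_derivative_compose by fast
    then have 1: "((\<lambda>t. t * f x) has_derivative (\<lambda>t. t * D x)) (at 0)"
      by (simp add: assms(2) D.scaleR)
    have 2: "((\<lambda>t. t * f x) has_derivative (\<lambda>t. t * f x)) (at 0)"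
      by (auto intro!: derivative_eq_intros)
    from has_derivative_unique[OF 1 2] show ?thesis
      by (metis mult_1)
  qed
  then have "f = D" by blast
  then show ?thesis using D.linear_axioms by simp
qed

text \<open>Passing to the type of univariate polynomials gives access to degrees and to the absence
  of zero divisors.\<close>

lemma real_polynomial_function_imp_poly:
  fixes f :: "real \<Rightarrow> real"
  assumes "real_polynomial_function f"
  shows "\<exists>p. f = poly p"
  using assms
proof induction
  case (linear f)
  then have "f x = poly [:0, f 1:] x" for x
    using linear_scale[OF bounded_linear.linear, of f x 1] by simp
  then show ?case by blast
next
  case (const c)
  have "(\<lambda>x. c) = poly [:c:]" by auto
  then show ?case by blast
next
  case (add f g)
  then obtain p q where "f = poly p" "g = poly q" by blast
  then have "(\<lambda>x. f x + g x) = poly (p + q)" by auto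
  then show ?case by blast
next
  case (mult f g)
  then obtain p q where "f = poly p" "g = poly q" by blast
  then have "(\<lambda>x. f x * g x) = poly (p * q)" by auto
  then show ?case by blast
qed

lemma real_polynomial_function_on_line:
  assumes "real_polynomial_function f"
  shows "\<exists>p. \<forall>t. f (a + t *\<^sub>R b) = poly p t"
proof -
  have "polynomial_function (\<lambda>t::real. a + t *\<^sub>R b)"
    by (intro polynomial_function_add polynomial_function_const polynomial_function_bounded_linear)
       (rule bounded_linear_scaleR_left)
  from real_polynomial_function_compose[OF this assms] show ?thesis
    by (auto dest!: real_polynomial_function_imp_poly simp: fun_eq_iff)
qed

text \<open>Join a point where f is nonzero to a point where g is nonzero. On that line both
  restrict to nonzero univariate polynomials, whose product cannot vanish.\<close>

lemma real_polynomial_function_idom: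
  fixes f g :: "'a::real_normed_vector \<Rightarrow> real"
  assumes "real_polynomial_function f" "real_polynomial_function g" "\<And>x. f x * g x = 0"
  shows "(\<forall>x. f x = 0) \<or> (\<forall>x. g x = 0)"
proof (rule ccontr)
  assume "\<not> ?thesis"
  then obtain a b where ab: "f a \<noteq> 0" "g b \<noteq> 0" by blast
  obtain p where p: "\<And>t. f (a + t *\<^sub>R (b - a)) = poly p t"
    using real_polynomial_function_on_line[OF assms(1)] by blast
  obtain q where q: "\<And>t. g (a + t *\<^sub>R (b - a)) = poly q t"
    using real_polynomial_function_on_line[OF assms(2)] by blast
  have "poly (p * q) t = 0" for t
    using p q assms(3) by (metis poly_mult)
  then have "p * q = 0" using poly_all_0_iff_0 by blast
  then show False
    using p[of 0] q[of 1] ab by auto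
qed

section \<open>Divisibility by \<open>x \<bullet> x\<close>\<close>

text \<open>In dimension four this stands for vanishing on the complex null cone of
  \<open>x \<bullet> x\<close>. The real cone is only the origin, so divisibility replaces
  evaluation at null vectors.\<close>

definition norm_dvd :: "('a::real_inner \<Rightarrow> real) \<Rightarrow> bool" where
  "norm_dvd p \<longleftrightarrow> (\<exists>q. real_polynomial_function q \<and> (\<forall>x. p x = (x \<bullet> x) * q x))"

lemma norm_dvd_add: "norm_dvd p \<Longrightarrow> norm_dvd q \<Longrightarrow> norm_dvd (\<lambda>x. p x + q x)"
  unfolding norm_dvd_def
proof (elim exE conjE)
  fix r s :: "'a \<Rightarrow> real"
  assume "real_polynomial_function r" "real_polynomial_function s"
    "\<forall>x. p x = (x \<bullet> x) * r x" "\<forall>x. q x = (x \<bullet> x) * s x"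
  then show "\<exists>r. real_polynomial_function r \<and> (\<forall>x. p x + q x = (x \<bullet> x) * r x)"
    by (intro exI[of _ "\<lambda>x. r x + s x"]) (auto simp: distrib_left)
qed

lemma norm_dvd_mult: "norm_dvd p \<Longrightarrow> real_polynomial_function q \<Longrightarrow> norm_dvd (\<lambda>x. q x * p x)"
  unfolding norm_dvd_def
proof (elim exE conjE)
  fix r assume "real_polynomial_function q" "real_polynomial_function r" "\<forall>x. p x = (x \<bullet> x) * r x"
  then show "\<exists>r. real_polynomial_function r \<and> (\<forall>x. q x * p x = (x \<bullet> x) * r x)"
    by (intro exI[of _ "\<lambda>x. q x * r x"]) auto
qed

lemma norm_dvd_mult2: "norm_dvd p \<Longrightarrow> real_polynomial_function q \<Longrightarrow> norm_dvd (\<lambda>x. p x * q x)"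
  using norm_dvd_mult by (simp add: mult.commute)

lemma norm_dvd_scale: "norm_dvd p \<Longrightarrow> norm_dvd (\<lambda>x. c * p x)"
  by (rule norm_dvd_mult) auto

lemma norm_dvd_diff: "norm_dvd p \<Longrightarrow> norm_dvd q \<Longrightarrow> norm_dvd (\<lambda>x. p x - q x)"
  using norm_dvd_add[of p "\<lambda>x. -1 * q x"] norm_dvd_scale[of q "-1"] by simp

lemma norm_dvd_zero: "norm_dvd (\<lambda>x. 0)"
  unfolding norm_dvd_def by (intro exI[of _ "\<lambda>_. 0"]) auto

lemma norm_dvd_sum: "(\<And>i. i \<in> I \<Longrightarrow> norm_dvd (f i)) \<Longrightarrow> norm_dvd (\<lambda>x. \<Sum>i\<in>I. f i x)"
  by (induction I rule: infinite_finite_induct) (simp_all add: norm_dvd_zero norm_dvd_add)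

text \<open>Division by the quadratic \<open>x \<bullet> x\<close>, monic in the first coordinate: the remainder is
  \<open>r + x\<^sub>1 s\<close> with \<open>r\<close> and \<open>s\<close> independent of \<open>x\<^sub>1\<close>.\<close>

definition first_free :: "(real^4 \<Rightarrow> real) \<Rightarrow> bool" where
  "first_free f \<longleftrightarrow> real_polynomial_function f \<and> (\<forall>x t. f (x + t *\<^sub>R axis 1 1) = f x)"

lemma first_free_add: "first_free f \<Longrightarrow> first_free g \<Longrightarrow> first_free (\<lambda>x. f x + g x)"
  and first_free_diff: "first_free f \<Longrightarrow> first_free g \<Longrightarrow> first_free (\<lambda>x. f x - g x)"
  and first_free_mult: "first_free f \<Longrightarrow> first_free g \<Longrightarrow> first_free (\<lambda>x. f x * g x)"
  and first_free_const: "first_free (\<lambda>x. c)"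
  by (auto simp: first_free_def)

text \<open>Modulo \<open>x \<bullet> x\<close>, the square of the first coordinate is
  \<open>- rest_sq x\<close>.\<close>

definition rest_sq :: "real^4 \<Rightarrow> real" where
  "rest_sq x = x \<bullet> x - (x$1)\<^sup>2"

lemma rest_sq_eq: "rest_sq x = (x$2)\<^sup>2 + (x$3)\<^sup>2 + (x$4)\<^sup>2"
  by (simp add: rest_sq_def inner_vec_def sum_4 power2_eq_square)

lemma first_free_rest_sq: "first_free rest_sq"
  unfolding first_free_def rest_sq_eq
  by (auto intro!: real_polynomial_function_nth real_polynomial_function_power
      real_polynomial_function_add simp: rest_sq_eq[abs_def] axis_def)

text \<open>With X for \<open>x \<bullet> x\<close> and a for the first coordinate, the term with
  a^2 in the product is rewritten by a^2 = X - (X - a^2), where X - a^2 is \<open>rest_sq\<close>;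
  the multiples of X go into the quotient.\<close>

lemma norm_division_mult:
  fixes X :: real
  shows "(X * q + r + a * s) * (X * q' + r' + a * s') =
    X * (q * (X * q' + r' + a * s') + (r + a * s) * q' + s * s')
    + (r * r' - (X - a\<^sup>2) * (s * s')) + a * (r * s' + s * r')"
  by (simp add: algebra_simps power2_eq_square)

text \<open>Induction on the construction of p. A linear form splits into its value with the first
  coordinate deleted and a constant multiple of that coordinate; products are reduced by
  \<open>norm_division_mult\<close>.\<close>

lemma norm_division:
  assumes "real_polynomial_function p"
  shows "\<exists>q r s. real_polynomial_function q \<and> first_free r \<and> first_free s \<and>
           (\<forall>x. p x = (x \<bullet> x) * q x + r x + x$1 * s x)"
  using assms
proof induction
  case (linear f)
  interpret bounded_linear f by fact
  let ?r = "\<lambda>x::real^4. f (x - x$1 *\<^sub>R axis 1 1)"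
  have "bounded_linear ?r"
    by (intro bounded_linear_compose[OF bounded_linear_axioms] bounded_linear_sub bounded_linear_ident
        bounded_linear_scaleR_const bounded_linear_vec_nth)
  then have "first_free ?r"
    by (auto simp: first_free_def scaleR_add_left axis_def)
  then show ?case
    by (intro exI[of _ "\<lambda>x. 0"] exI[of _ ?r] exI[of _ "\<lambda>x. f (axis 1 1)"])
       (auto simp: diff scaleR first_free_const)
next
  case (const c)
  show ?case
    by (intro exI[of _ "\<lambda>x. 0"] exI[of _ "\<lambda>x. c"]) (auto simp: first_free_const)
next
  case (add f g)
  then obtain q r s q' r' s' where
    "real_polynomial_function q" "first_free r" "first_free s" "\<forall>x. f x = (x \<bullet> x) * q x + r x + x$1 * s x"
    "real_polynomial_function q'" "first_free r'" "first_free s'" "\<forall>x. g x = (x \<bullet> x) * q' x + r' x + x$1 * s' x"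
    by metis
  then show ?case
    by (intro exI[of _ "\<lambda>x. q x + q' x"] exI[of _ "\<lambda>x. r x + r' x"] exI[of _ "\<lambda>x. s x + s' x"])
       (auto simp: first_free_add algebra_simps)
next
  case (mult f g)
  then obtain q r s q' r' s' where
    *: "real_polynomial_function q" "first_free r" "first_free s" "\<And>x. f x = (x \<bullet> x) * q x + r x + x$1 * s x"
    "real_polynomial_function q'" "first_free r'" "first_free s'" "\<And>x. g x = (x \<bullet> x) * q' x + r' x + x$1 * s' x"
    by metis
  let ?q = "\<lambda>x. q x * g x + (r x + x$1 * s x) * q' x + s x * s' x"
  let ?r = "\<lambda>x. r x * r' x - rest_sq x * (s x * s' x)"
  let ?s = "\<lambda>x. r x * s' x + s x * r' x"
  have "real_polynomial_function ?q"
    using *(1-3,5-7) mult.hyps unfolding first_free_def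
    by (intro real_polynomial_function_add real_polynomial_function_mult real_polynomial_function_nth) auto
  moreover have "first_free ?r" "first_free ?s"
    using * by (auto intro!: first_free_diff first_free_add first_free_mult first_free_rest_sq)
  moreover have "f x * g x = (x \<bullet> x) * ?q x + ?r x + x$1 * ?s x" for x
    unfolding *(4,8) rest_sq_def by (rule norm_division_mult)
  ultimately show ?case
    by (intro exI[of _ ?q] exI[of _ ?r] exI[of _ ?s] conjI allI)
qed

text \<open>This is uniqueness of the remainder. Along the first axis the left side has degree at
  most one in the parameter, whereas a nonzero multiple of the monic quadratic has degree at least
  two.\<close>

lemma norm_dvd_remainder_zero:
  assumes "first_free r" "first_free s" "norm_dvd (\<lambda>x. r x + x$1 * s x)"
  shows "r x = 0" "s x = 0"
proof -
  obtain q where q: "real_polynomial_function q" "\<And>x. r x + x$1 * s x = (x \<bullet> x) * q x"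
    using assms(3) by (auto simp: norm_dvd_def)
  obtain h where h: "\<And>t. q (x + t *\<^sub>R axis 1 1) = poly h t"
    using real_polynomial_function_on_line[OF q(1)] by blast
  \<comment> \<open>The remainder and \<open>x \<bullet> x\<close> at the point displaced by t along
    the first axis, as polynomials in t.\<close>
  let ?l = "[:r x + x$1 * s x, s x:]" and ?d = "[:x \<bullet> x, 2 * x$1, 1:]"
  have "poly ?l t = poly (?d * h) t" for t
  proof -
    have 1: "(x + t *\<^sub>R axis 1 1) \<bullet> (x + t *\<^sub>R axis 1 1) = x \<bullet> x + 2 * t * x$1 + t\<^sup>2"
      by (simp add: inner_add_left inner_add_right inner_axis inner_axis' power2_eq_square distrib_left)
    have 2: "(x + t *\<^sub>R axis 1 1) $ 1 = x $ 1 + t" by (simp add: axis_def)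
    have 3: "r (x + t *\<^sub>R axis 1 1) = r x" "s (x + t *\<^sub>R axis 1 1) = s x"
      using assms(1,2) by (auto simp: first_free_def)
    show ?thesis
      using q(2)[of "x + t *\<^sub>R axis 1 1"] unfolding 1 2 3 h poly_mult poly_pCons poly_0
      by algebra
  qed
  then have eq: "?l = ?d * h" by (simp add: poly_eq_poly_eq_iff[symmetric] fun_eq_iff)
  have "h = 0"
  proof (rule ccontr)
    assume "h \<noteq> 0"
    then have "degree (?d * h) = 2 + degree h"
      by (subst degree_mult_eq) auto
    moreover have "degree ?l \<le> 1" by simp
    ultimately show False using eq by simp
  qed
  then show "r x = 0" "s x = 0" using eq by auto
qed

text \<open>The remainders of the factors multiply to the remainder of the product, which is zero by
  uniqueness. A multiplicative norm then forces one of the two remainders to vanish.\<close>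

lemma norm_dvd_prime:
  fixes p p' :: "real^4 \<Rightarrow> real"
  assumes "real_polynomial_function p" "real_polynomial_function p'" "norm_dvd (\<lambda>x. p x * p' x)"
  shows "norm_dvd p \<or> norm_dvd p'"
proof -
  obtain q r s where q: "real_polynomial_function q" "first_free r" "first_free s"
      "\<And>x. p x = (x \<bullet> x) * q x + r x + x$1 * s x"
    using norm_division[OF assms(1)] by blast
  obtain q' r' s' where q': "real_polynomial_function q'" "first_free r'" "first_free s'"
      "\<And>x. p' x = (x \<bullet> x) * q' x + r' x + x$1 * s' x"
    using norm_division[OF assms(2)] by blast
  let ?r = "\<lambda>x. r x * r' x - rest_sq x * (s x * s' x)"
  let ?s = "\<lambda>x. r x * s' x + s x * r' x"
  let ?m = "\<lambda>x. q x * p' x + (r x + x$1 * s x) * q' x + s x * s' x"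
  have ff: "first_free ?r" "first_free ?s"
    using q q' by (auto intro!: first_free_diff first_free_add first_free_mult first_free_rest_sq)
  have "real_polynomial_function ?m"
    using q(1-3) q'(1-3) assms(1,2) unfolding first_free_def
    by (intro real_polynomial_function_add real_polynomial_function_mult real_polynomial_function_nth) auto
  then have "norm_dvd (\<lambda>x. (x \<bullet> x) * ?m x)"
    unfolding norm_dvd_def by blast
  from norm_dvd_diff[OF assms(3) this]
  have "norm_dvd (\<lambda>x. p x * p' x - (x \<bullet> x) * ?m x)" .
  moreover have "p x * p' x - (x \<bullet> x) * ?m x = ?r x + x$1 * ?s x" for x
    unfolding q(4) q'(4) rest_sq_def by (subst norm_division_mult) simp
  ultimately have dv: "norm_dvd (\<lambda>x. ?r x + x$1 * ?s x)" by simp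
  text \<open>\<open>r\<^sup>2 + rest_sq s\<^sup>2\<close> is the norm of \<open>r + x\<^sub>1 s\<close> modulo \<open>x \<bullet> x\<close>; it is positive definite
    over the reals, and it is multiplicative.\<close>
  let ?N = "\<lambda>x. (r x)\<^sup>2 + rest_sq x * (s x)\<^sup>2" and ?N' = "\<lambda>x. (r' x)\<^sup>2 + rest_sq x * (s' x)\<^sup>2"
  have N: "?N x * ?N' x = 0" for x
  proof -
    \<comment> \<open>Brahmagupta's identity for the form u^2 + c v^2 with c =
      \<open>rest_sq x\<close>.\<close>
    have "?N x * ?N' x = (?r x)\<^sup>2 + rest_sq x * (?s x)\<^sup>2" by algebra
    then show ?thesis
      using norm_dvd_remainder_zero[OF ff dv, of x] by simp
  qed
  have poly: "real_polynomial_function r" "real_polynomial_function s" "real_polynomial_function r'"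
    "real_polynomial_function s'" "real_polynomial_function rest_sq"
    using q q' first_free_rest_sq by (auto simp: first_free_def)
  have sq0: "(\<forall>x. u x = 0) \<and> (\<forall>x. v x = 0)"
    if "\<forall>x. (u x)\<^sup>2 + rest_sq x * (v x)\<^sup>2 = 0" "real_polynomial_function v" for u v :: "real^4 \<Rightarrow> real"
  proof -
    have *: "(u x)\<^sup>2 = 0 \<and> rest_sq x * (v x)\<^sup>2 = 0" for x
    proof -
      have "rest_sq x * (v x)\<^sup>2 \<ge> 0" by (simp add: rest_sq_eq)
      then show ?thesis
        using that(1) by (smt (verit) zero_le_power2)
    qed
    \<comment> \<open>Since \<open>rest_sq\<close> vanishes on the first axis, it cannot be
      cancelled pointwise everywhere; it is cancelled as a nonzero polynomial.\<close>
    have "(\<forall>x. rest_sq x = 0) \<or> (\<forall>x. (v x)\<^sup>2 = 0)"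
      using * by (intro real_polynomial_function_idom poly real_polynomial_function_power that) auto
    moreover have "rest_sq (axis 2 1) \<noteq> 0"
      by (simp add: rest_sq_eq axis_def)
    ultimately show ?thesis using * by auto
  qed
  have "(\<forall>x. ?N x = 0) \<or> (\<forall>x. ?N' x = 0)"
    by (intro real_polynomial_function_idom N real_polynomial_function_add real_polynomial_function_mult
        real_polynomial_function_power poly)
  then show ?thesis
  proof
    assume "\<forall>x. ?N x = 0"
    from sq0[OF this poly(2)] show ?thesis
      using q by (auto simp: norm_dvd_def)
  next
    assume "\<forall>x. ?N' x = 0"
    from sq0[OF this poly(4)] show ?thesis
      using q' by (auto simp: norm_dvd_def)
  qed
qed

lemma norm_dvd_square:
  fixes p :: "real^4 \<Rightarrow> real"
  assumes "real_polynomial_function p" "norm_dvd (\<lambda>x. (p x)\<^sup>2)"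
  shows "norm_dvd p"
  using norm_dvd_prime[of p p] assms by (simp add: power2_eq_square)

section \<open>Taylor expansion along rays\<close>

text \<open>An o(t^k) bound on the derivative integrates to o(t^(k+1)): the mean value inequality
  between 0 and t supplies the extra factor |t|.\<close>

lemma tendsto_zero_integrate:
  fixes e E :: "real \<Rightarrow> 'a::real_inner"
  assumes "\<forall>\<^sub>F t in nhds 0. (e has_vector_derivative E t) (at t)"
    and "e 0 = 0" and "((\<lambda>t. E t /\<^sub>R t ^ k) \<longlongrightarrow> 0) (at 0)"
  shows "((\<lambda>t. e t /\<^sub>R t ^ Suc k) \<longlongrightarrow> 0) (at 0)"
proof (rule tendstoI)
  fix r :: real assume r: "r > 0"
  obtain d1 where d1: "d1 > 0" "\<And>t. \<bar>t\<bar> < d1 \<Longrightarrow> (e has_vector_derivative E t) (at t)"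
    using assms(1) by (auto simp: eventually_nhds_metric dist_real_def)
  have "\<forall>\<^sub>F t in at 0. dist (E t /\<^sub>R t ^ k) 0 < r"
    using assms(3) r by (rule tendstoD)
  then obtain d2 where d2: "d2 > 0" "\<And>t. t \<noteq> 0 \<Longrightarrow> \<bar>t\<bar> < d2 \<Longrightarrow> norm (E t /\<^sub>R t ^ k) < r"
    by (auto simp: eventually_at dist_real_def)
  have "norm (e t /\<^sub>R t ^ Suc k) < r" if t: "t \<noteq> 0" "\<bar>t\<bar> < min d1 d2" for t
  proof -
    \<comment> \<open>Ordered endpoints treat positive and negative t together.\<close>
    let ?a = "min 0 t" and ?b = "max 0 t"
    have d: "(e has_derivative (\<lambda>h. h *\<^sub>R E s)) (at s)" if "s \<in> {?a..?b}" for s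
      using d1(2)[of s] that t by (auto simp: has_vector_derivative_def)
    have "\<exists>s\<in>{?a<..<?b}. norm (e ?b - e ?a) \<le> norm ((?b - ?a) *\<^sub>R E s)"
    proof (rule mvt_general)
      show "?a < ?b" using t by auto
      show "continuous_on {?a..?b} e"
        using d by (meson continuous_at_imp_continuous_on has_derivative_continuous)
      show "(e has_derivative (\<lambda>h. h *\<^sub>R E s)) (at s)" if "?a < s" "s < ?b" for s
        using d[of s] that by auto
    qed
    then obtain s where s: "s \<in> {?a<..<?b}" "norm (e ?b - e ?a) \<le> norm ((?b - ?a) *\<^sub>R E s)" by blast
    have ne: "norm (e t) \<le> \<bar>t\<bar> * norm (E s)"
      using s(2) assms(2) by (auto simp: min_def max_def split: if_splits)
    have s': "s \<noteq> 0" "\<bar>s\<bar> \<le> \<bar>t\<bar>" using s(1) by auto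
    have "norm (E s) / \<bar>s\<bar> ^ k < r"
      using d2(2)[of s] s' t by (simp add: power_abs divide_inverse mult.commute)
    then have "norm (E s) < r * \<bar>s\<bar> ^ k"
      using s' by (simp add: pos_divide_less_eq)
    also have "\<dots> \<le> r * \<bar>t\<bar> ^ k"
      using s' r by (intro mult_left_mono power_mono) auto
    finally have "\<bar>t\<bar> * norm (E s) < \<bar>t\<bar> * (r * \<bar>t\<bar> ^ k)" using t by simp
    with ne have "norm (e t) < r * \<bar>t\<bar> ^ Suc k" by (simp add: mult_ac)
    then have "norm (e t) / \<bar>t\<bar> ^ Suc k < r"
      using t by (subst pos_divide_less_eq) auto
    then show ?thesis by (simp add: power_abs divide_inverse mult_ac abs_mult)
  qed
  then show "\<forall>\<^sub>F t in at 0. dist (e t /\<^sub>R t ^ Suc k) 0 < r"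
    using d1(1) d2(1) unfolding eventually_at dist_real_def by (intro exI[of _ "min d1 d2"]) auto
qed

text \<open>Induction on k: expand the partial derivatives of f along the ray, combine them into the
  derivative in direction A x, and integrate. Having A inside makes the coefficients polynomials in
  x, the velocity before rectification; the clause on \<open>P 1\<close> identifies the linear
  term.\<close>

lemma Ck_taylor_rays:
  fixes f :: "real^4 \<Rightarrow> real^4"
  assumes "open U" "0 \<in> U" "linear A" "Ck k U f"
  shows "\<exists>P. (\<forall>i b. hom_poly i (\<lambda>x. P i x $ b)) \<and> (\<forall>x. P 0 x = f 0) \<and>
    (\<forall>x f'. k > 0 \<longrightarrow> (f has_derivative f') (at 0) \<longrightarrow> P 1 x = f' (A x)) \<and>
    (\<forall>x. ((\<lambda>t. (f (t *\<^sub>R A x) - (\<Sum>i\<le>k. t ^ i *\<^sub>R P i x)) /\<^sub>R t ^ k) \<longlongrightarrow> 0) (at 0))"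
  using assms(4)
proof (induction k arbitrary: f)
  case 0
  let ?P = "\<lambda>i x. if i = (0::nat) then f 0 else 0"
  have "((\<lambda>t. f (t *\<^sub>R A x)) \<longlongrightarrow> f (0 *\<^sub>R A x)) (at 0)" for x
  proof -
    have "isCont f (0 *\<^sub>R A x)"
      using 0 assms(1,2) by (simp add: continuous_on_eq_continuous_at)
    then have "isCont (\<lambda>t. f (t *\<^sub>R A x)) 0"
      by (rule isCont_o2[rotated]) (intro continuous_intros)
    then show ?thesis by (simp add: isCont_def)
  qed
  then have "((\<lambda>t. f (t *\<^sub>R A x) - f 0) \<longlongrightarrow> 0) (at 0)" for x
    using LIM_zero[where l = "f 0" and F = "at 0" and f = "\<lambda>t. f (t *\<^sub>R A x)"] by simp
  moreover have "hom_poly i (\<lambda>x. ?P i x $ b)" for i b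
    by (cases i) (simp_all add: hom_poly_zero hom_poly_const)
  ultimately show ?case by (intro exI[of _ ?P]) auto
next
  case (Suc k)
  from Suc.prems[unfolded Ck.simps(2)] obtain D where D: "\<And>x. x \<in> U \<Longrightarrow> (f has_derivative D x) (at x)"
      "\<And>v. v \<in> Basis \<Longrightarrow> Ck k U (\<lambda>x. D x v)"
    by blast
  have "\<forall>v\<in>Basis. \<exists>P. (\<forall>i b. hom_poly i (\<lambda>x. P i x $ b)) \<and> (\<forall>x. P 0 x = D 0 v) \<and>
    (\<forall>x. ((\<lambda>t. (D (t *\<^sub>R A x) v - (\<Sum>i\<le>k. t ^ i *\<^sub>R P i x)) /\<^sub>R t ^ k) \<longlongrightarrow> 0) (at 0))"
    using Suc.IH[OF D(2)] by blast
  from bchoice[OF this] obtain R where R: "\<And>v i b. v \<in> Basis \<Longrightarrow> hom_poly i (\<lambda>x. R v i x $ b)"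
    "\<And>v x. v \<in> Basis \<Longrightarrow> R v 0 x = D 0 v"
    "\<And>v x. v \<in> Basis \<Longrightarrow>
      ((\<lambda>t. (D (t *\<^sub>R A x) v - (\<Sum>i\<le>k. t ^ i *\<^sub>R R v i x)) /\<^sub>R t ^ k) \<longlongrightarrow> 0) (at 0)"
    by blast
  \<comment> \<open>\<open>Q i\<close> is the coefficient of t^i in the derivative of f along the
    ray; the factor \<open>A x \<bullet> v\<close> raises its degree in x to i + 1.\<close>
  define Q where "Q i x = (\<Sum>v\<in>Basis. (A x \<bullet> v) *\<^sub>R R v i x)" for i x
  \<comment> \<open>Integrating t^j gives the divisor j + 1 and shifts the index by one.\<close>
  define P where "P i x = (case i of 0 \<Rightarrow> f 0 | Suc j \<Rightarrow> Q j x /\<^sub>R real (Suc j))" for i x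
  have Q: "hom_poly (Suc i) (\<lambda>x. Q i x $ b)" for i b
  proof -
    have "hom_poly (1 + i) (\<lambda>x. (A x \<bullet> v) * R v i x $ b)" if v_Basis: "v \<in> Basis" for v
    proof -
      obtain j where v: "v = axis j 1"
        using v_Basis by (auto simp: Basis_vec_def)
      have "hom_poly 1 (\<lambda>x. A x \<bullet> v)"
        unfolding v using hom_poly_linear[OF assms(3), of j] by (simp add: inner_axis)
      then show ?thesis
        using R(1)[OF v_Basis] by (rule hom_poly_mult)
    qed
    then show ?thesis
      unfolding Q_def by (simp add: hom_poly_sum)
  qed
  have P: "hom_poly i (\<lambda>x. P i x $ b)" for i b
    unfolding P_def using Q by (cases i) (auto intro!: hom_poly_const hom_poly_scale)
  moreover have "((\<lambda>t. (f (t *\<^sub>R A x) - (\<Sum>i\<le>Suc k. t ^ i *\<^sub>R P i x)) /\<^sub>R t ^ Suc k) \<longlongrightarrow> 0) (at 0)" for x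
  proof (rule tendsto_zero_integrate)
    let ?E = "\<lambda>t. D (t *\<^sub>R A x) (A x) - (\<Sum>i\<le>k. t ^ i *\<^sub>R Q i x)"
    have op: "open ((\<lambda>t::real. t *\<^sub>R A x) -` U)"
      using assms(1) by (intro open_vimage continuous_intros) auto
    have ev: "\<forall>\<^sub>F t in nhds 0. t *\<^sub>R A x \<in> U"
      using eventually_nhds_in_open[OF op, of 0] assms(2) by simp
    have lin: "D (t *\<^sub>R A x) (A x) = (\<Sum>v\<in>Basis. (A x \<bullet> v) *\<^sub>R D (t *\<^sub>R A x) v)" if "t *\<^sub>R A x \<in> U" for t
    proof -
      interpret bounded_linear "D (t *\<^sub>R A x)"
        using D(1)[OF that] by (rule has_derivative_bounded_linear)
      have "D (t *\<^sub>R A x) (A x) = D (t *\<^sub>R A x) (\<Sum>v\<in>Basis. (A x \<bullet> v) *\<^sub>R v)"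
        by (simp add: euclidean_representation)
      then show ?thesis by (simp add: sum scaleR)
    qed
    have s: "(\<Sum>i\<le>Suc k. t ^ i *\<^sub>R P i x) = f 0 + (\<Sum>i\<le>k. (t ^ Suc i / real (Suc i)) *\<^sub>R Q i x)" for t :: real
      by (simp only: sum.atMost_Suc_shift P_def) (simp add: divide_inverse)
    show "\<forall>\<^sub>F t in nhds 0. ((\<lambda>t. f (t *\<^sub>R A x) - (\<Sum>i\<le>Suc k. t ^ i *\<^sub>R P i x)) has_vector_derivative ?E t) (at t)"
      using ev
    proof eventually_elim
      case (elim t)
      have "((\<lambda>t. f (t *\<^sub>R A x)) has_derivative (\<lambda>h. D (t *\<^sub>R A x) (h *\<^sub>R A x))) (at t)"
        by (rule has_derivative_compose[where f = "\<lambda>t. t *\<^sub>R A x", OF _ D(1)[OF elim]]) (auto intro!: derivative_eq_intros)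
      then have 1: "((\<lambda>t. f (t *\<^sub>R A x)) has_vector_derivative D (t *\<^sub>R A x) (A x)) (at t)"
        using has_derivative_bounded_linear[OF D(1)[OF elim]]
        by (simp add: has_vector_derivative_def bounded_linear.linear linear_cmul)
      have 2: "((\<lambda>t. (t ^ Suc i / real (Suc i)) *\<^sub>R Q i x) has_vector_derivative t ^ i *\<^sub>R Q i x) (at t)" for i
      proof -
        have "((\<lambda>t. t ^ Suc i / real (Suc i)) has_real_derivative t ^ i) (at t)"
          by (rule derivative_eq_intros refl | simp)+
        from has_vector_derivative_scaleR[OF this has_vector_derivative_const[of "Q i x"]]
        show ?thesis by simp
      qed
      show ?case
        unfolding s
        by (rule derivative_eq_intros 1 2 has_vector_derivative_sum refl | simp)+
    qed
    show "f (0 *\<^sub>R A x) - (\<Sum>i\<le>Suc k. 0 ^ i *\<^sub>R P i x) = 0"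
      unfolding s by simp
    have "((\<lambda>t. \<Sum>v\<in>Basis. (A x \<bullet> v) *\<^sub>R ((D (t *\<^sub>R A x) v - (\<Sum>i\<le>k. t ^ i *\<^sub>R R v i x)) /\<^sub>R t ^ k)) \<longlongrightarrow>
        (\<Sum>v\<in>Basis. (A x \<bullet> v) *\<^sub>R 0)) (at 0)"
      by (intro tendsto_intros R(3))
    then have "((\<lambda>t. \<Sum>v\<in>Basis. (A x \<bullet> v) *\<^sub>R ((D (t *\<^sub>R A x) v - (\<Sum>i\<le>k. t ^ i *\<^sub>R R v i x)) /\<^sub>R t ^ k)) \<longlongrightarrow> 0) (at 0)"
      by simp
    moreover have "\<forall>\<^sub>F t in at 0. (\<Sum>v\<in>Basis. (A x \<bullet> v) *\<^sub>R ((D (t *\<^sub>R A x) v - (\<Sum>i\<le>k. t ^ i *\<^sub>R R v i x)) /\<^sub>R t ^ k))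
        = ?E t /\<^sub>R t ^ k"
    proof -
      have "\<forall>\<^sub>F t in at 0. t *\<^sub>R A x \<in> U"
        using ev by (simp add: eventually_nhds_conv_at)
      then show ?thesis
      proof eventually_elim
        case (elim t)
        have "(\<Sum>i\<le>k. t ^ i *\<^sub>R Q i x) = (\<Sum>v\<in>Basis. (A x \<bullet> v) *\<^sub>R (\<Sum>i\<le>k. t ^ i *\<^sub>R R v i x))"
          unfolding Q_def scaleR_sum_right by (subst sum.swap) (simp add: mult.commute)
        then show ?case
          unfolding lin[OF elim]
          by (simp add: sum_subtractf scaleR_diff_right scaleR_sum_right mult_ac)
      qed
    qed
    ultimately show "((\<lambda>t. ?E t /\<^sub>R t ^ k) \<longlongrightarrow> 0) (at 0)"
      using Lim_transform_eventually by fast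
  qed
  moreover have "P 1 x = f' (A x)" if f': "(f has_derivative f') (at 0)" for x f'
  proof -
    have "f' = D 0"
      using f' D(1)[OF assms(2)] by (rule has_derivative_unique)
    interpret bounded_linear f'
      using f' by (rule has_derivative_bounded_linear)
    have "P 1 x = (\<Sum>v\<in>Basis. (A x \<bullet> v) *\<^sub>R f' v)"
      by (simp add: P_def Q_def R(2) \<open>f' = D 0\<close>)
    also have "\<dots> = f' (\<Sum>v\<in>Basis. (A x \<bullet> v) *\<^sub>R v)"
      by (simp add: sum scaleR)
    finally show ?thesis
      by (simp add: euclidean_representation)
  qed
  moreover have "P 0 x = f 0" for x by (simp add: P_def)
  ultimately show ?case by blast
qed

section \<open>Jets of circles\<close>

lemma circle_curve_continuous:
  assumes "circle_curve \<gamma>"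
  shows "continuous_on UNIV \<gamma>"
  using assms unfolding circle_curve_def circle_param_def[abs_def] line_param_def[abs_def]
  by (auto intro!: continuous_intros)

lemma circle_curve_differentiable:
  assumes "circle_curve \<gamma>"
  shows "\<exists>w. (\<gamma> has_vector_derivative w) (at t)"
proof -
  have "((\<lambda>t. c + r *\<^sub>R (cos t *\<^sub>R u + sin t *\<^sub>R v)) has_vector_derivative
      r *\<^sub>R (- sin t *\<^sub>R u + cos t *\<^sub>R v)) (at t)" for c u v :: "real^4" and r
    by (auto intro!: derivative_eq_intros)
  moreover have "((\<lambda>t. p + t *\<^sub>R d) has_vector_derivative d) (at t)" for p d :: "real^4"
    by (auto intro!: derivative_eq_intros)
  ultimately show ?thesis
    using assms unfolding circle_curve_def circle_param_def[abs_def] line_param_def[abs_def] by blast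
qed

text \<open>Inversion in the unit sphere turns a circle through \<open>0\<close> with tangent vector \<open>w\<close> into a line
  \<open>m + \<real> w\<close>; this is its equation before inversion. A line has \<open>m = 0\<close>.\<close>

lemma circle_curve_through_0:
  assumes "circle_curve \<gamma>" "\<gamma> t0 = 0" "(\<gamma> has_vector_derivative w) (at t0)"
  shows "w \<noteq> 0" "\<exists>m. \<forall>t. \<exists>s. \<gamma> t = (\<gamma> t \<bullet> \<gamma> t) *\<^sub>R m + s *\<^sub>R w"
proof -
  have "w \<noteq> 0 \<and> (\<exists>m. \<forall>t. \<exists>s. \<gamma> t = (\<gamma> t \<bullet> \<gamma> t) *\<^sub>R m + s *\<^sub>R w)"
    using assms(1) unfolding circle_curve_def
  proof (elim disjE exE conjE)
    fix c r u v
    assume r: "r > 0" and n: "norm u = 1" "norm v = 1" "u \<bullet> v = 0" and g: "\<gamma> = circle_param c r u v"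
    \<comment> \<open>The unit vectors a (radial) and b (tangential) at the parameter of the origin;
      the centre is then -r a.\<close>
    define a where "a = cos t0 *\<^sub>R u + sin t0 *\<^sub>R v"
    define b where "b = - sin t0 *\<^sub>R u + cos t0 *\<^sub>R v"
    have c: "c = - (r *\<^sub>R a)"
      using assms(2) unfolding g circle_param_def a_def by (simp add: eq_neg_iff_add_eq_0)
    have uv: "u \<bullet> u = 1" "v \<bullet> v = 1" "v \<bullet> u = 0"
      using n by (auto simp: norm_eq_1 inner_commute)
    have aa: "a \<bullet> a = 1" and bb: "b \<bullet> b = 1" and ab: "a \<bullet> b = 0" and ba: "b \<bullet> a = 0"
      using sin_cos_squared_add[of t0]
      by (simp_all add: a_def b_def inner_add_left inner_add_right uv n(3) power2_eq_square algebra_simps)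
    have "((\<lambda>t. c + r *\<^sub>R (cos t *\<^sub>R u + sin t *\<^sub>R v)) has_vector_derivative r *\<^sub>R b) (at t0)"
      unfolding b_def by (auto intro!: derivative_eq_intros)
    then have w: "w = r *\<^sub>R b"
      using vector_derivative_unique_at[OF assms(3)[unfolded g circle_param_def[abs_def]]] by blast
    have "b \<noteq> 0" using bb by auto
    then have "w \<noteq> 0" using w r by auto
    \<comment> \<open>The squared norm is 2 r^2 (1 - cos d) and the radial component is r (cos d -
      1) a, so their ratio gives m = -a / (2 r).\<close>
    moreover have "\<exists>s. \<gamma> t = (\<gamma> t \<bullet> \<gamma> t) *\<^sub>R ((- 1 / (2 * r)) *\<^sub>R a) + s *\<^sub>R w" for t
    proof -
      define d where "d = t - t0"
      have t: "t = d + t0" by (simp add: d_def)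
      have gt: "\<gamma> t = r *\<^sub>R ((cos d - 1) *\<^sub>R a + sin d *\<^sub>R b)"
        unfolding g circle_param_def c t cos_add sin_add
        by (simp add: a_def b_def algebra_simps)
      have "(r *\<^sub>R (\<alpha> *\<^sub>R a + \<beta> *\<^sub>R b)) \<bullet> (r *\<^sub>R (\<alpha> *\<^sub>R a + \<beta> *\<^sub>R b)) = r\<^sup>2 * (\<alpha>\<^sup>2 + \<beta>\<^sup>2)" for \<alpha> \<beta>
        by (simp add: inner_add_left inner_add_right aa bb ab ba power2_eq_square algebra_simps)
      then have "\<gamma> t \<bullet> \<gamma> t = r\<^sup>2 * ((cos d - 1)\<^sup>2 + (sin d)\<^sup>2)"
        unfolding gt .
      also have "(cos d - 1)\<^sup>2 + (sin d)\<^sup>2 = 2 - 2 * cos d"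
        using sin_cos_squared_add[of d] by (simp add: power2_eq_square algebra_simps)
      finally have gg: "\<gamma> t \<bullet> \<gamma> t = r\<^sup>2 * (2 - 2 * cos d)" .
      have coef: "r\<^sup>2 * (2 - 2 * cos d) * (- 1 / (2 * r)) = r * (cos d - 1)"
        using r by (simp add: power2_eq_square field_simps)
      have "(\<gamma> t \<bullet> \<gamma> t) *\<^sub>R ((- 1 / (2 * r)) *\<^sub>R a) = (r * (cos d - 1)) *\<^sub>R a"
        unfolding gg by (simp only: scaleR_scaleR coef)
      then have "\<gamma> t = (\<gamma> t \<bullet> \<gamma> t) *\<^sub>R ((- 1 / (2 * r)) *\<^sub>R a) + sin d *\<^sub>R w"
        by (simp add: gt w scaleR_add_right mult.commute)
      then show ?thesis by blast
    qed
    ultimately show ?thesis by blast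
  next
    fix p d :: "real^4"
    assume d: "d \<noteq> 0" and g: "\<gamma> = line_param p d"
    have "((\<lambda>t. p + t *\<^sub>R d) has_vector_derivative d) (at t0)"
      by (auto intro!: derivative_eq_intros)
    then have w: "w = d"
      using vector_derivative_unique_at[OF assms(3)[unfolded g line_param_def[abs_def]]] by blast
    have p: "p = - (t0 *\<^sub>R d)"
      using assms(2) unfolding g line_param_def by (simp add: eq_neg_iff_add_eq_0)
    have "\<gamma> t = (\<gamma> t \<bullet> \<gamma> t) *\<^sub>R 0 + (t - t0) *\<^sub>R w" for t
      unfolding g line_param_def w p by (simp add: algebra_simps)
    then show ?thesis using d w by blast
  qed
  then show "w \<noteq> 0" "\<exists>m. \<forall>t. \<exists>s. \<gamma> t = (\<gamma> t \<bullet> \<gamma> t) *\<^sub>R m + s *\<^sub>R w" by blast+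
qed

text \<open>The limit at 0 kills the constant term; dividing by t and repeating kills the other
  two.\<close>

lemma quadratic_germ_zero:
  fixes c0 c1 c2 :: real
  assumes "\<forall>\<^sub>F t in at 0. c0 + t * c1 + t\<^sup>2 * (c2 + \<rho> t) = 0" "(\<rho> \<longlongrightarrow> 0) (at 0)"
  shows "c0 = 0" "c1 = 0" "c2 = 0"
proof -
  have "((\<lambda>t. c0 + t * c1 + t\<^sup>2 * (c2 + \<rho> t)) \<longlongrightarrow> c0 + 0 * c1 + 0\<^sup>2 * (c2 + 0)) (at 0)"
    by (intro tendsto_intros assms(2))
  from Lim_transform_eventually[OF this assms(1)] have "((\<lambda>t. 0) \<longlongrightarrow> c0) (at (0::real))"
    by simp
  then show c0: "c0 = 0" by (simp add: tendsto_const_iff)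
  have ne: "\<forall>\<^sub>F t in at (0::real). t \<noteq> 0" by (simp add: eventually_at_filter)
  have e1: "\<forall>\<^sub>F t in at 0. c1 + t * (c2 + \<rho> t) = 0"
    using assms(1) ne
  proof eventually_elim
    case (elim t)
    then have "t * (c1 + t * (c2 + \<rho> t)) = 0" using c0 by (simp add: power2_eq_square algebra_simps)
    then show ?case using elim by simp
  qed
  have "((\<lambda>t. c1 + t * (c2 + \<rho> t)) \<longlongrightarrow> c1 + 0 * (c2 + 0)) (at 0)"
    by (intro tendsto_intros assms(2))
  from Lim_transform_eventually[OF this e1] have "((\<lambda>t. 0) \<longlongrightarrow> c1) (at (0::real))"
    by simp
  then show c1: "c1 = 0" by (simp add: tendsto_const_iff)
  have e2: "\<forall>\<^sub>F t in at 0. c2 + \<rho> t = 0"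
    using e1 ne by eventually_elim (use c1 in auto)
  have "((\<lambda>t. c2 + \<rho> t) \<longlongrightarrow> c2 + 0) (at 0)"
    by (intro tendsto_intros assms(2))
  from Lim_transform_eventually[OF this e2] have "((\<lambda>t. 0) \<longlongrightarrow> c2) (at (0::real))"
    by simp
  then show "c2 = 0" by (simp add: tendsto_const_iff)
qed

text \<open>Pluecker coordinates of the plane of u and v; wedging with the tangent vector removes
  multiples of it.\<close>

definition wedge :: "real^4 \<Rightarrow> real^4 \<Rightarrow> 4 \<Rightarrow> 4 \<Rightarrow> real" where
  "wedge u v i j = u$i * v$j - u$j * v$i"

lemma wedge_add: "wedge (u + u') v i j = wedge u v i j + wedge u' v i j"
  and wedge_scale: "wedge (a *\<^sub>R u) v i j = a * wedge u v i j"
  and wedge_self: "wedge v v i j = 0"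
  by (simp_all add: wedge_def algebra_simps)

text \<open>Wedging the circle equation with x eliminates s and leaves p \<and> x = |p|^2 (m \<and>
  x). The three conclusions are the coefficients of t^2, t^3 and t^4; the leading term t x
  contributes nothing on the left.\<close>

lemma circle_jet:
  fixes x Q K M m :: "real^4"
  assumes "((\<lambda>t. (p t - (t *\<^sub>R x + t^2 *\<^sub>R Q + t^3 *\<^sub>R K + t^4 *\<^sub>R M)) /\<^sub>R t^4) \<longlongrightarrow> 0) (at 0)"
    and "\<forall>\<^sub>F t in at 0. \<exists>s. p t = (p t \<bullet> p t) *\<^sub>R m + s *\<^sub>R x"
  shows "wedge Q x i j = (x \<bullet> x) * wedge m x i j"
    and "wedge K x i j = 2 * (x \<bullet> Q) * wedge m x i j"
    and "wedge M x i j = (Q \<bullet> Q + 2 * (x \<bullet> K)) * wedge m x i j"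
proof -
  define r where "r t = (p t - (t *\<^sub>R x + t^2 *\<^sub>R Q + t^3 *\<^sub>R K + t^4 *\<^sub>R M)) /\<^sub>R t^4" for t
  have r: "(r \<longlongrightarrow> 0) (at 0)" using assms(1) by (simp add: r_def[abs_def])
  \<comment> \<open>The quartic term and the error become a vanishing perturbation of K, so that p =
    t (x + t Q + t^2 (K + \<sigma>)).\<close>
  define \<sigma> where "\<sigma> t = t *\<^sub>R (M + r t)" for t
  have \<sigma>: "(\<sigma> \<longlongrightarrow> 0) (at 0)"
  proof -
    have "(\<sigma> \<longlongrightarrow> 0 *\<^sub>R (M + 0)) (at 0)"
      unfolding \<sigma>_def by (intro tendsto_intros r)
    then show ?thesis by simp
  qed
  have p: "p t = t *\<^sub>R (x + t *\<^sub>R Q + t^2 *\<^sub>R (K + \<sigma> t))" if "t \<noteq> 0" for t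
  proof -
    have "t^4 *\<^sub>R r t = p t - (t *\<^sub>R x + t^2 *\<^sub>R Q + t^3 *\<^sub>R K + t^4 *\<^sub>R M)"
      using that by (simp add: r_def)
    then have "p t = t *\<^sub>R x + t^2 *\<^sub>R Q + t^3 *\<^sub>R K + t^4 *\<^sub>R M + t^4 *\<^sub>R r t" by simp
    then show ?thesis
      by (simp add: \<sigma>_def scaleR_add_right power2_eq_square power3_eq_cube power4_eq_xxxx mult.assoc)
  qed
  define \<mu> where "\<mu> = wedge m x i j"
  \<comment> \<open>The part of |p|^2 / t^2 beyond its second-order expansion, divided by
    t^2.\<close>
  define e where "e t = 2 * (x \<bullet> \<sigma> t) + 2 * t * (Q \<bullet> (K + \<sigma> t)) + t^2 * ((K + \<sigma> t) \<bullet> (K + \<sigma> t))" for t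
  define \<rho> where "\<rho> t = wedge (r t) x i j - \<mu> * e t" for t
  have e: "(e \<longlongrightarrow> 2 * (x \<bullet> 0) + 2 * 0 * (Q \<bullet> (K + 0)) + 0^2 * ((K + 0) \<bullet> (K + 0))) (at 0)"
    unfolding e_def by (intro tendsto_intros \<sigma>)
  have w: "((\<lambda>t. wedge (r t) x i j) \<longlongrightarrow> 0 $ i * x $ j - 0 $ j * x $ i) (at 0)"
    unfolding wedge_def by (intro tendsto_intros r)
  have "(\<rho> \<longlongrightarrow> (0 $ i * x $ j - 0 $ j * x $ i) - \<mu> * (2 * (x \<bullet> 0) + 2 * 0 * (Q \<bullet> (K + 0)) + 0^2 * ((K + 0) \<bullet> (K + 0)))) (at 0)"
    unfolding \<rho>_def by (intro tendsto_intros e w)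
  then have \<rho>: "(\<rho> \<longlongrightarrow> 0) (at 0)" by simp
  have ne: "\<forall>\<^sub>F t in at (0::real). t \<noteq> 0" by (simp add: eventually_at_filter)
  have ev: "\<forall>\<^sub>F t in at 0. (wedge Q x i j - (x \<bullet> x) * \<mu>) + t * (wedge K x i j - 2 * (x \<bullet> Q) * \<mu>)
      + t^2 * ((wedge M x i j - (Q \<bullet> Q + 2 * (x \<bullet> K)) * \<mu>) + \<rho> t) = 0"
    using assms(2) ne
  proof eventually_elim
    case (elim t)
    let ?N = "x \<bullet> x + t * (2 * (x \<bullet> Q)) + t^2 * (Q \<bullet> Q + 2 * (x \<bullet> K) + e t)"
    let ?W = "wedge Q x i j + t * wedge K x i j + t^2 * (wedge M x i j + wedge (r t) x i j)"
    have N: "p t \<bullet> p t = t^2 * ?N"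
      unfolding p[OF elim(2)] e_def
      by (simp add: inner_add_left inner_add_right inner_commute power2_eq_square algebra_simps)
    obtain s where "p t = (p t \<bullet> p t) *\<^sub>R m + s *\<^sub>R x" using elim by blast
    then have "wedge (p t) x i j = wedge ((p t \<bullet> p t) *\<^sub>R m + s *\<^sub>R x) x i j" by simp
    then have 1: "wedge (p t) x i j = t^2 * (?N * \<mu>)"
      by (simp only: wedge_add wedge_scale wedge_self \<mu>_def N)
    have 2: "wedge (p t) x i j = t^2 * ?W"
      unfolding p[OF elim(2)] \<sigma>_def
      by (simp add: wedge_add wedge_scale wedge_self power2_eq_square algebra_simps)
    have "?W = ?N * \<mu>" using 1 2 elim(2) by simp
    then show ?case unfolding \<rho>_def by (simp add: algebra_simps)
  qed
  from quadratic_germ_zero[OF ev \<rho>]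
  show "wedge Q x i j = (x \<bullet> x) * wedge m x i j"
    "wedge K x i j = 2 * (x \<bullet> Q) * wedge m x i j"
    "wedge M x i j = (Q \<bullet> Q + 2 * (x \<bullet> K)) * wedge m x i j"
    by (simp_all add: \<mu>_def)
qed

section \<open>From the jet identities to divisibility\<close>

lemma wedge_zero_imp_parallel:
  assumes "\<And>i j. wedge u x i j = 0" "x \<noteq> 0"
  shows "\<exists>k. u = k *\<^sub>R x"
proof -
  have "(x \<bullet> x) * u $ i = (u \<bullet> x) * x $ i" for i
  proof -
    have "(x \<bullet> x) * u $ i = (\<Sum>j\<in>UNIV. x $ j * (u $ i * x $ j))"
      by (simp add: inner_vec_def sum_distrib_left sum_distrib_right mult_ac)
    also have "\<dots> = (\<Sum>j\<in>UNIV. x $ j * (u $ j * x $ i))"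
      using assms(1) by (simp add: wedge_def)
    also have "\<dots> = (u \<bullet> x) * x $ i"
      by (simp add: inner_vec_def sum_distrib_left sum_distrib_right mult_ac)
    finally show ?thesis .
  qed
  then have "u = ((u \<bullet> x) / (x \<bullet> x)) *\<^sub>R x"
    using assms(2) by (simp add: vec_eq_iff field_simps)
  then show ?thesis by blast
qed

text \<open>Lagrange's identity; the factor 2 counts each pair of indices in both orders.\<close>

lemma sum_wedge_squares:
  "(\<Sum>i\<in>UNIV. \<Sum>j\<in>UNIV. (wedge u v i j)\<^sup>2) = 2 * ((u \<bullet> u) * (v \<bullet> v) - (u \<bullet> v)\<^sup>2)"
  by (simp add: wedge_def inner_vec_def sum_4 power2_eq_square algebra_simps)

lemma real_polynomial_function_inner:
  fixes F G :: "real^4 \<Rightarrow> real^4"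
  assumes "\<And>i. real_polynomial_function (\<lambda>x. F x $ i)" "\<And>i. real_polynomial_function (\<lambda>x. G x $ i)"
  shows "real_polynomial_function (\<lambda>x. F x \<bullet> G x)"
  unfolding inner_vec_def inner_real_def
  by (intro real_polynomial_function_sum finite real_polynomial_function_mult assms)

lemma real_polynomial_function_wedge:
  assumes "\<And>i. real_polynomial_function (\<lambda>x. F x $ i)"
  shows "real_polynomial_function (\<lambda>x. wedge (F x) x i j)"
  unfolding wedge_def
  by (intro real_polynomial_function_diff real_polynomial_function_mult assms real_polynomial_function_nth)

lemma norm_dvd_self_mult: "real_polynomial_function q \<Longrightarrow> norm_dvd (\<lambda>x. (x \<bullet> x) * q x)"
  unfolding norm_dvd_def by blast

text \<open>By Lagrange's identity (x \<bullet> Q)^2 is |x|^2 |Q|^2 minus half the sum of squared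
  wedge coordinates. Both are divisible, and \<open>x \<bullet> x\<close> is prime.\<close>

lemma norm_dvd_wedge_imp_inner:
  fixes Q :: "real^4 \<Rightarrow> real^4"
  assumes Q: "\<And>i. real_polynomial_function (\<lambda>x. Q x $ i)"
    and W: "\<And>i j. norm_dvd (\<lambda>x. wedge (Q x) x i j)"
  shows "norm_dvd (\<lambda>x. x \<bullet> Q x)"
proof (rule norm_dvd_square)
  show "real_polynomial_function (\<lambda>x. x \<bullet> Q x)"
    by (intro real_polynomial_function_inner real_polynomial_function_nth Q)
  have "norm_dvd (\<lambda>x. \<Sum>i\<in>UNIV. \<Sum>j\<in>UNIV. (wedge (Q x) x i j)\<^sup>2)"
    unfolding power2_eq_square by (intro norm_dvd_sum norm_dvd_mult W real_polynomial_function_wedge Q)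
  then have 1: "norm_dvd (\<lambda>x. 2 * ((Q x \<bullet> Q x) * (x \<bullet> x) - (Q x \<bullet> x)\<^sup>2))"
    by (simp only: sum_wedge_squares)
  have 2: "norm_dvd (\<lambda>x. (x \<bullet> x) * (Q x \<bullet> Q x))"
    by (intro norm_dvd_self_mult real_polynomial_function_inner Q)
  have "norm_dvd (\<lambda>x. (x \<bullet> x) * (Q x \<bullet> Q x) - 1 / 2 * (2 * ((Q x \<bullet> Q x) * (x \<bullet> x) - (Q x \<bullet> x)\<^sup>2)))"
    by (rule norm_dvd_diff[OF 2 norm_dvd_scale[OF 1]])
  then show "norm_dvd (\<lambda>x. (x \<bullet> Q x)\<^sup>2)"
    by (simp add: inner_commute algebra_simps)
qed

text \<open>Primality applied to I1 makes x \<bullet> Q divisible: either directly, or through the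
  wedge coordinates. Then I1 yields divisibility of x \<bullet> K, after which I2 gives the same
  alternative for Q \<bullet> Q.\<close>

lemma norm_dvd_osculating:
  fixes Q K M :: "real^4 \<Rightarrow> real^4"
  assumes Q: "\<And>i. real_polynomial_function (\<lambda>x. Q x $ i)"
    and K: "\<And>i. real_polynomial_function (\<lambda>x. K x $ i)"
    and M: "\<And>i. real_polynomial_function (\<lambda>x. M x $ i)"
    and Q0: "Q 0 = 0"
    and I1: "\<And>x i j. (x \<bullet> x) * wedge (K x) x i j = 2 * (x \<bullet> Q x) * wedge (Q x) x i j"
    and I2: "\<And>x i j. (x \<bullet> x) * wedge (M x) x i j = (Q x \<bullet> Q x + 2 * (x \<bullet> K x)) * wedge (Q x) x i j"
  shows "norm_dvd (\<lambda>x. x \<bullet> Q x)" "norm_dvd (\<lambda>x. Q x \<bullet> Q x)"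
proof -
  have xQ: "real_polynomial_function (\<lambda>x. x \<bullet> Q x)" and QQ: "real_polynomial_function (\<lambda>x. Q x \<bullet> Q x)"
    by (intro real_polynomial_function_inner real_polynomial_function_nth Q)+
  note W = real_polynomial_function_wedge
  have "norm_dvd (\<lambda>x. (x \<bullet> Q x) * wedge (Q x) x i j)" for i j
  proof -
    have "norm_dvd (\<lambda>x. 1 / 2 * ((x \<bullet> x) * wedge (K x) x i j))"
      by (intro norm_dvd_scale norm_dvd_self_mult W K)
    then show ?thesis unfolding I1 by (simp add: mult.assoc)
  qed
  then have "norm_dvd (\<lambda>x. x \<bullet> Q x) \<or> norm_dvd (\<lambda>x. wedge (Q x) x i j)" for i j
    by (intro norm_dvd_prime xQ W Q)
  then show dxQ: "norm_dvd (\<lambda>x. x \<bullet> Q x)"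
    using norm_dvd_wedge_imp_inner[OF Q] by blast
  then obtain l where l: "real_polynomial_function l" "\<And>x. x \<bullet> Q x = (x \<bullet> x) * l x"
    by (auto simp: norm_dvd_def)
  \<comment> \<open>With x \<bullet> Q = |x|^2 l, cancelling |x|^2 in I1 says exactly that Y = K - 2
    l Q is parallel to x.\<close>
  define Y where "Y x = K x + (- 2 * l x) *\<^sub>R Q x" for x
  have Y: "real_polynomial_function (\<lambda>x. Y x $ i)" for i
    unfolding Y_def by (simp, intro real_polynomial_function_diff real_polynomial_function_mult K Q l
        real_polynomial_function_const)
  have WY: "wedge (Y x) x i j = 0" for x i j
  proof (cases "x = 0")
    case False
    have "(x \<bullet> x) * wedge (Y x) x i j = 0"
      unfolding Y_def wedge_add wedge_scale using I1[of x i j] l(2)[of x] by (simp add: algebra_simps)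
    then show ?thesis using False by simp
  qed (simp add: wedge_def)
  have "norm_dvd (\<lambda>x. x \<bullet> Y x)"
    by (rule norm_dvd_wedge_imp_inner[OF Y]) (simp add: WY norm_dvd_zero)
  moreover have "norm_dvd (\<lambda>x. 2 * l x * (x \<bullet> Q x))"
    by (intro norm_dvd_mult dxQ real_polynomial_function_mult real_polynomial_function_const l)
  ultimately have "norm_dvd (\<lambda>x. x \<bullet> Y x + 2 * l x * (x \<bullet> Q x))"
    by (rule norm_dvd_add)
  then have dxK: "norm_dvd (\<lambda>x. x \<bullet> K x)"
    by (simp add: Y_def inner_diff_right)
  have "norm_dvd (\<lambda>x. (Q x \<bullet> Q x) * wedge (Q x) x i j)" for i j
  proof -
    have "norm_dvd (\<lambda>x. (x \<bullet> x) * wedge (M x) x i j - 2 * ((x \<bullet> K x) * wedge (Q x) x i j))"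
      by (intro norm_dvd_diff norm_dvd_scale norm_dvd_self_mult norm_dvd_mult2 dxK W Q M)
    then show ?thesis unfolding I2 by (simp add: algebra_simps)
  qed
  then have "norm_dvd (\<lambda>x. Q x \<bullet> Q x) \<or> norm_dvd (\<lambda>x. wedge (Q x) x i j)" for i j
    by (intro norm_dvd_prime QQ W Q)
  then consider "norm_dvd (\<lambda>x. Q x \<bullet> Q x)" | "\<forall>i j. norm_dvd (\<lambda>x. wedge (Q x) x i j)" by blast
  then show "norm_dvd (\<lambda>x. Q x \<bullet> Q x)"
  proof cases
    case 2
    then have "\<forall>i. \<forall>j. \<exists>q. real_polynomial_function q \<and> (\<forall>x. wedge (Q x) x i j = (x \<bullet> x) * q x)"
      unfolding norm_dvd_def .
    then obtain q where q: "\<And>i j. real_polynomial_function (q i j)"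
        "\<And>i j x. wedge (Q x) x i j = (x \<bullet> x) * q i j x"
      by metis
    \<comment> \<open>The quotient of Q \<bullet> Q read off from Lagrange's identity after dividing
      by |x|^4. At the origin, where this division fails, Q vanishes.\<close>
    let ?s = "\<lambda>x. 1 / 2 * (\<Sum>i\<in>UNIV. \<Sum>j\<in>UNIV. (q i j x)\<^sup>2) + (l x)\<^sup>2"
    have "Q x \<bullet> Q x = (x \<bullet> x) * ?s x" for x
    proof (cases "x = 0")
      case False
      have "(x \<bullet> x)\<^sup>2 * (\<Sum>i\<in>UNIV. \<Sum>j\<in>UNIV. (q i j x)\<^sup>2) = 2 * ((Q x \<bullet> Q x) * (x \<bullet> x) - ((x \<bullet> x) * l x)\<^sup>2)"
        using sum_wedge_squares[of "Q x" x] l(2)[of x]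
        by (simp add: q(2) power_mult_distrib inner_commute flip: sum_distrib_left)
      then have "(x \<bullet> x) * (Q x \<bullet> Q x) = (x \<bullet> x) * ((x \<bullet> x) * ?s x)"
        by (simp add: power2_eq_square algebra_simps)
      then show ?thesis using False by simp
    qed (simp add: Q0)
    moreover have "real_polynomial_function ?s"
      by (intro real_polynomial_function_add real_polynomial_function_mult real_polynomial_function_const
          real_polynomial_function_sum finite real_polynomial_function_power q l)
    ultimately show ?thesis unfolding norm_dvd_def by blast
  qed
qed

section \<open>Quaternionic quadratic maps\<close>

lemma qmult_nth:
  "qmult p q $ 1 = p$1*q$1 - p$2*q$2 - p$3*q$3 - p$4*q$4"
  "qmult p q $ 2 = p$1*q$2 + p$2*q$1 + p$3*q$4 - p$4*q$3"
  "qmult p q $ 3 = p$1*q$3 - p$2*q$4 + p$3*q$1 + p$4*q$2"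
  "qmult p q $ 4 = p$1*q$4 + p$2*q$3 - p$3*q$2 + p$4*q$1"
  by (simp_all add: qmult_def vector_def)

lemma qconj_nth: "qconj q $ 1 = q$1" "qconj q $ 2 = - q$2" "qconj q $ 3 = - q$3" "qconj q $ 4 = - q$4"
  by (simp_all add: qconj_def vector_def)

lemma inner_4: "x \<bullet> y = x$1*y$1 + x$2*y$2 + x$3*y$3 + x$4*y$4" for x y :: "real^4"
  by (simp add: inner_vec_def sum_4)

lemma vec4_eq_iff: "x = y \<longleftrightarrow> x$1 = y$1 \<and> x$2 = y$2 \<and> x$3 = y$3 \<and> x$4 = y$4" for x y :: "real^4"
  by (simp add: vec_eq_iff forall_4)

lemma qmult_assoc: "qmult (qmult a b) c = qmult a (qmult b c)"
  by (simp add: vec4_eq_iff qmult_nth algebra_simps)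

lemma bilinear_qmult: "bilinear qmult"
  unfolding bilinear_def
  by (auto intro!: linearI simp: vec4_eq_iff qmult_nth algebra_simps)

lemmas qmult_simps =
  bilinear_ladd[OF bilinear_qmult] bilinear_radd[OF bilinear_qmult]
  bilinear_lsub[OF bilinear_qmult] bilinear_rsub[OF bilinear_qmult]
  bilinear_lmul[OF bilinear_qmult] bilinear_rmul[OF bilinear_qmult]
  bilinear_lzero[OF bilinear_qmult] bilinear_rzero[OF bilinear_qmult]

lemma qmult_conj_cancel:
  "qmult (qmult q (qconj x)) x = (x \<bullet> x) *\<^sub>R q" "qmult x (qmult (qconj x) q) = (x \<bullet> x) *\<^sub>R q"
  by (simp_all add: vec4_eq_iff qmult_nth qconj_nth inner_4 algebra_simps)

text \<open>As ab plus its conjugate is the scalar 2 (a \<bullet> \<open>qconj b\<close>),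
  multiplying by a on the right gives the formula.\<close>

lemma qmult_sandwich: "qmult a (qmult b a) = (2 * (a \<bullet> qconj b)) *\<^sub>R a - (a \<bullet> a) *\<^sub>R qconj b"
  by (simp add: vec4_eq_iff qmult_nth qconj_nth inner_4 algebra_simps)

lemma qconj_qconj: "qconj (qconj q) = q"
  and inner_qconj: "qconj x \<bullet> qconj y = x \<bullet> y"
  by (simp_all add: vec4_eq_iff qconj_nth inner_4)

text \<open>The \<open>|x|\<^sup>2\<close>-divisibility of \<open>x \<bullet> q\<close> and \<open>q \<bullet> q\<close> thus passes to \<open>(q x\<^sup>*) w (x\<^sup>* q)\<close>, for every
  \<open>w\<close>.\<close>

lemma qmult_isotropic:
  "qmult (qmult q (qconj x)) (qmult w (qmult (qconj x) q)) =
   (2 * (qconj x \<bullet> qconj w)) *\<^sub>R ((2 * (x \<bullet> q)) *\<^sub>R q - (q \<bullet> q) *\<^sub>R x)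
   - (x \<bullet> x) *\<^sub>R qmult q (qmult (qconj w) q)"
proof -
  have "qmult (qmult q (qconj x)) (qmult w (qmult (qconj x) q)) =
      qmult q (qmult (qmult (qconj x) (qmult w (qconj x))) q)"
    by (simp add: qmult_assoc)
  also have "\<dots> = (2 * (qconj x \<bullet> qconj w)) *\<^sub>R qmult q (qmult (qconj x) q)
      - (x \<bullet> x) *\<^sub>R qmult q (qmult (qconj w) q)"
    by (simp add: qmult_sandwich[of "qconj x"] inner_qconj qmult_simps)
  also have "qmult q (qmult (qconj x) q) = (2 * (x \<bullet> q)) *\<^sub>R q - (q \<bullet> q) *\<^sub>R x"
    by (simp add: qmult_sandwich qconj_qconj inner_commute)
  finally show ?thesis by simp
qed

text \<open>\<open>\<Sum>\<^sub>e e p e\<^sup>* = 4 Re p\<close>, summed over the units \<open>e = 1, i, j, k\<close>.\<close>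

lemma qmult_component_product:
  "4 * (p $ a * r $ b) =
    (\<Sum>i\<in>UNIV. qmult (axis i 1) (qmult p (qmult (qmult (qconj (axis a 1)) (qconj (axis i 1))) r)) $ b)"
proof -
  have re: "(4 * q $ 1) *\<^sub>R r = (\<Sum>i\<in>UNIV. qmult (axis i 1) (qmult q (qmult (qconj (axis i 1)) r)))" for q
    by (simp add: vec4_eq_iff sum_4 qmult_nth qconj_nth axis_def)
  \<comment> \<open>Multiplication by a conjugate unit moves the chosen coordinate into the real
    part, so the sum over units applies to every coordinate.\<close>
  have "\<forall>a. qmult p (qconj (axis a 1)) $ 1 = p $ a"
    unfolding forall_4 by (simp add: qmult_nth qconj_nth axis_def)
  then have "4 * (p $ a * r $ b) = ((4 * qmult p (qconj (axis a 1)) $ 1) *\<^sub>R r) $ b"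
    by simp
  then show ?thesis
    unfolding re by (simp add: qmult_assoc)
qed

lemma norm_dvd_qmult_const:
  assumes "\<And>b. norm_dvd (\<lambda>x. F x $ b)"
  shows "norm_dvd (\<lambda>x. qmult e (F x) $ b)"
proof -
  have "\<forall>b. norm_dvd (\<lambda>x. qmult e (F x) $ b)"
    unfolding forall_4 qmult_nth
    by (intro conjI norm_dvd_add norm_dvd_diff norm_dvd_scale assms)
  then show ?thesis by blast
qed

lemma real_polynomial_function_qmult:
  assumes "\<And>b. real_polynomial_function (\<lambda>x. F x $ b)" "\<And>b. real_polynomial_function (\<lambda>x. G x $ b)"
  shows "real_polynomial_function (\<lambda>x. qmult (F x) (G x) $ b)"
proof -
  have "\<forall>b. real_polynomial_function (\<lambda>x. qmult (F x) (G x) $ b)"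
    unfolding forall_4 qmult_nth
    by (intro conjI real_polynomial_function_add real_polynomial_function_diff real_polynomial_function_mult assms)
  then show ?thesis by blast
qed

lemma hom_poly_qmult:
  assumes "\<And>b. hom_poly d (\<lambda>x. F x $ b)" "\<And>b. hom_poly e (\<lambda>x. G x $ b)"
  shows "hom_poly (d + e) (\<lambda>x. qmult (F x) (G x) $ b)"
proof -
  have "\<forall>b. hom_poly (d + e) (\<lambda>x. qmult (F x) (G x) $ b)"
    unfolding forall_4 qmult_nth
    by (intro conjI hom_poly_add hom_poly_diff hom_poly_mult assms)
  then show ?thesis by blast
qed

lemma hom_poly_qconj: "hom_poly 1 (\<lambda>x. qconj x $ b)"
  by (rule hom_poly_linear) (auto intro!: linearI simp: vec4_eq_iff qconj_nth)

text \<open>The quotient of a cubic by a quadratic is homogeneous of degree one away from the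
  origin, and continuity settles the origin.\<close>

lemma norm_dvd_cubic_imp_linear:
  assumes "hom_poly 3 p" "norm_dvd p"
  shows "\<exists>l. linear l \<and> (\<forall>x. p x = (x \<bullet> x) * l x)"
proof -
  obtain q where q: "real_polynomial_function q" "\<And>x. p x = (x \<bullet> x) * q x"
    using assms(2) by (auto simp: norm_dvd_def)
  have h: "q (t *\<^sub>R x) = t * q x" if "t \<noteq> 0" "x \<noteq> 0" for t x
  proof -
    have "(t^2 * (x \<bullet> x)) * q (t *\<^sub>R x) = (t^2 * (x \<bullet> x)) * (t * q x)"
      using hom_poly_homogeneous[OF assms(1), of t x]
      by (simp add: q(2) power2_eq_square power3_eq_cube mult_ac)
    then show ?thesis using that by simp
  qed
  let ?e = "axis 1 1 :: real^4"
  \<comment> \<open>The equation p = |x|^2 q leaves q 0 free, so its value comes from the limit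
    along a ray.\<close>
  have "isCont q 0" by (rule continuous_real_polymonial_function[OF q(1)])
  then have "((\<lambda>t. q (t *\<^sub>R ?e)) \<longlongrightarrow> q 0) (at 0)"
    by (rule isCont_tendsto_compose) (auto intro!: tendsto_eq_intros)
  moreover have "\<forall>\<^sub>F t in at 0. q (t *\<^sub>R ?e) = t * q ?e"
    using h[of _ ?e] by (auto simp: eventually_at_filter)
  ultimately have "((\<lambda>t. t * q ?e) \<longlongrightarrow> q 0) (at 0)"
    by (rule Lim_transform_eventually)
  moreover have "((\<lambda>t. t * q ?e) \<longlongrightarrow> 0) (at (0::real))"
    by (auto intro!: tendsto_eq_intros)
  ultimately have "q 0 = 0" by (rule LIM_unique)
  then have "q (t *\<^sub>R x) = t * q x" for t x
    using h[of t x] by (cases "t = 0"; cases "x = 0") auto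
  then have "linear q"
    by (rule real_polynomial_function_homogeneous_imp_linear[OF q(1)])
  then show ?thesis using q(2) by blast
qed

lemma norm_dvd_qmult_imp_linear:
  assumes "\<And>b. hom_poly 3 (\<lambda>x. F x $ b)" "\<And>b. norm_dvd (\<lambda>x. F x $ b)"
  shows "\<exists>\<beta>. linear \<beta> \<and> (\<forall>x. F x = (x \<bullet> x) *\<^sub>R \<beta> x)"
proof -
  have "\<forall>b. \<exists>l. linear l \<and> (\<forall>x. F x $ b = (x \<bullet> x) * l x)"
    using norm_dvd_cubic_imp_linear[OF assms] by blast
  from choice[OF this] obtain l where l: "\<And>b. linear (l b)" "\<And>b x. F x $ b = (x \<bullet> x) * l b x" by blast
  let ?\<beta> = "\<lambda>x. \<chi> b. l b x"
  have "linear ?\<beta>"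
    by (rule linearI) (simp_all add: vec_eq_iff linear_add[OF l(1)] linear_cmul[OF l(1)])
  moreover have "F x = (x \<bullet> x) *\<^sub>R ?\<beta> x" for x
    by (simp add: vec_eq_iff l(2))
  ultimately show ?thesis by blast
qed

text \<open>On the complex null cone the two families of isotropic planes through x are cut out by Q
  \<open>qconj x\<close> = 0 and \<open>qconj x\<close> Q = 0. Showing that every product of a
  component of the first with one of the second is divisible lets primality choose one family
  globally.\<close>

lemma isotropic_quadratic_is_quaternionic:
  fixes Q :: "real^4 \<Rightarrow> real^4"
  assumes Q: "\<And>b. hom_poly 2 (\<lambda>x. Q x $ b)"
    and xQ: "norm_dvd (\<lambda>x. x \<bullet> Q x)" and QQ: "norm_dvd (\<lambda>x. Q x \<bullet> Q x)"
  shows "\<exists>\<beta>. linear \<beta> \<and> ((\<forall>x. Q x = qmult (\<beta> x) x) \<or> (\<forall>x. Q x = qmult x (\<beta> x)))"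
proof -
  let ?P = "\<lambda>x. qmult (Q x) (qconj x)" and ?R = "\<lambda>x. qmult (qconj x) (Q x)"
  have Q0: "Q 0 = 0"
    using hom_poly_homogeneous[OF Q, of 0 0] by (simp add: vec_eq_iff)
  note Qp = hom_poly_imp_real_polynomial_function[OF Q]
  note cp = hom_poly_imp_real_polynomial_function[OF hom_poly_qconj]
  have P3: "hom_poly 3 (\<lambda>x. ?P x $ b)" and R3: "hom_poly 3 (\<lambda>x. ?R x $ b)" for b
    using hom_poly_qmult[OF Q hom_poly_qconj, of b] hom_poly_qmult[OF hom_poly_qconj Q, of b]
    by (simp_all add: numeral_eq_Suc)
  \<comment> \<open>Every term of \<open>qmult_isotropic\<close> carries one of the factors x
    \<bullet> x, x \<bullet> Q and Q \<bullet> Q.\<close>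
  have D: "norm_dvd (\<lambda>x. qmult (?P x) (qmult w (?R x)) $ b)" for w b
  proof -
    have c: "real_polynomial_function (\<lambda>x. qconj x \<bullet> qconj w)"
      by (intro real_polynomial_function_inner cp real_polynomial_function_const)
    have "norm_dvd (\<lambda>x. (2 * (qconj x \<bullet> qconj w)) * ((2 * (x \<bullet> Q x)) * Q x $ b - (Q x \<bullet> Q x) * x $ b)
        - (x \<bullet> x) * qmult (Q x) (qmult (qconj w) (Q x)) $ b)"
      by (intro norm_dvd_diff norm_dvd_self_mult real_polynomial_function_qmult Qp
          real_polynomial_function_const norm_dvd_mult real_polynomial_function_mult c
          norm_dvd_mult2[OF norm_dvd_scale[OF xQ]] norm_dvd_mult2[OF QQ] real_polynomial_function_nth)
    then show ?thesis unfolding qmult_isotropic by simp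
  qed
  have "norm_dvd (\<lambda>x. ?P x $ a * ?R x $ b)" for a b
  proof -
    have "norm_dvd (\<lambda>x. 1 / 4 * (4 * (?P x $ a * ?R x $ b)))"
      unfolding qmult_component_product
      by (intro norm_dvd_scale norm_dvd_sum norm_dvd_qmult_const D)
    then show ?thesis by simp
  qed
  then have "norm_dvd (\<lambda>x. ?P x $ a) \<or> norm_dvd (\<lambda>x. ?R x $ b)" for a b
    by (intro norm_dvd_prime hom_poly_imp_real_polynomial_function[OF P3]
        hom_poly_imp_real_polynomial_function[OF R3])
  \<comment> \<open>If one component of P is not divisible, pairing it with each component of R
    makes all of R divisible.\<close>
  then consider "\<And>a. norm_dvd (\<lambda>x. ?P x $ a)" | "\<And>b. norm_dvd (\<lambda>x. ?R x $ b)" by blast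
  then show ?thesis
  proof cases
    case 1
    from norm_dvd_qmult_imp_linear[OF P3 this]
    obtain \<beta> where \<beta>: "linear \<beta>" "\<And>x. ?P x = (x \<bullet> x) *\<^sub>R \<beta> x" by blast
    have "Q x = qmult (\<beta> x) x" for x
    proof (cases "x = 0")
      case True
      then show ?thesis
        using Q0 by (simp add: qmult_simps)
    next
      case False
      have "(x \<bullet> x) *\<^sub>R Q x = (x \<bullet> x) *\<^sub>R qmult (\<beta> x) x"
        using qmult_conj_cancel(1)[of "Q x" x] \<beta>(2)[of x] by (auto simp add: qmult_simps)
      then show ?thesis using False by auto
    qed
    then show ?thesis using \<beta>(1) by blast
  next
    case 2
    from norm_dvd_qmult_imp_linear[OF R3 this]
    obtain \<beta> where \<beta>: "linear \<beta>" "\<And>x. ?R x = (x \<bullet> x) *\<^sub>R \<beta> x" by blast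
    have "Q x = qmult x (\<beta> x)" for x
    proof (cases "x = 0")
      case True
      then show ?thesis
        using Q0 by (simp add: qmult_simps)
    next
      case False
      have "(x \<bullet> x) *\<^sub>R Q x = (x \<bullet> x) *\<^sub>R qmult x (\<beta> x)"
        using qmult_conj_cancel(2)[of x "Q x"] \<beta>(2)[of x] by (auto simp add: qmult_simps)
      then show ?thesis using False by auto
    qed
    then show ?thesis using \<beta>(1) by blast
  qed
qed

section \<open>Smooth maps\<close>

lemma Ck_continuous_on: "Ck k U f \<Longrightarrow> continuous_on U f"
proof (cases k)
  case (Suc j)
  assume "Ck k U f"
  then show ?thesis
    unfolding Suc Ck.simps(2)
    by (meson continuous_at_imp_continuous_on has_derivative_continuous)
qed simp

text \<open>Product and inverse rules for derivatives contain the undifferentiated function, whose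
  order must be lowered to match.\<close>

lemma Ck_mono_Suc: "Ck (Suc k) U f \<Longrightarrow> Ck k U f"
proof (induction k arbitrary: f)
  case 0
  then show ?case using Ck_continuous_on by fastforce
next
  case (Suc k)
  from Suc.prems obtain D where "\<forall>x\<in>U. (f has_derivative D x) (at x)" "\<forall>v\<in>Basis. Ck (Suc k) U (\<lambda>x. D x v)"
    unfolding Ck.simps(2)[of "Suc k"] by blast
  then show ?case using Suc.IH unfolding Ck.simps(2)[of k] by blast
qed

lemma Ck_SucI:
  assumes "\<And>x. x \<in> U \<Longrightarrow> (f has_derivative D x) (at x)" "\<And>v. v \<in> Basis \<Longrightarrow> Ck k U (\<lambda>x. D x v)"
  shows "Ck (Suc k) U f"
  using assms by auto

lemma Ck_const: "Ck k U (\<lambda>x. c)"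
proof (induction k arbitrary: c)
  case (Suc k)
  show ?case by (rule Ck_SucI[where D = "\<lambda>x v. 0"]) (auto intro: Suc)
qed simp

lemma Ck_bounded_linear: "bounded_linear h \<Longrightarrow> Ck k U h"
proof (induction k)
  case 0
  then show ?case by (simp add: linear_continuous_on)
next
  case (Suc k)
  show ?case
    by (rule Ck_SucI[where D = "\<lambda>x. h"]) (use Suc.prems in \<open>auto intro: bounded_linear_imp_has_derivative Ck_const\<close>)
qed

lemma Ck_bounded_linear_compose:
  assumes "bounded_linear h" "Ck k U f"
  shows "Ck k U (\<lambda>x. h (f x))"
  using assms(2)
proof (induction k arbitrary: f)
  case 0
  then show ?case using assms(1) by (auto intro: bounded_linear.continuous_on)
next
  case (Suc k)
  from Suc.prems[unfolded Ck.simps(2)]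
  obtain D where "\<forall>x\<in>U. (f has_derivative D x) (at x)" "\<forall>v\<in>Basis. Ck k U (\<lambda>x. D x v)" by blast
  then show ?case
    by (intro Ck_SucI[where D = "\<lambda>x v. h (D x v)"] Suc.IH bounded_linear.has_derivative[OF assms(1)]) auto
qed

lemma Ck_add:
  assumes "Ck k U f" "Ck k U g"
  shows "Ck k U (\<lambda>x. f x + g x)"
  using assms
proof (induction k arbitrary: f g)
  case 0
  then show ?case by (auto intro: continuous_intros)
next
  case (Suc k)
  from Suc.prems[unfolded Ck.simps(2)]
  obtain D E where "\<forall>x\<in>U. (f has_derivative D x) (at x)" "\<forall>v\<in>Basis. Ck k U (\<lambda>x. D x v)"
    "\<forall>x\<in>U. (g has_derivative E x) (at x)" "\<forall>v\<in>Basis. Ck k U (\<lambda>x. E x v)" by blast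
  then show ?case
    by (intro Ck_SucI[where D = "\<lambda>x v. D x v + E x v"] Suc.IH has_derivative_add) auto
qed

lemma Ck_sum: "(\<And>i. i \<in> I \<Longrightarrow> Ck k U (f i)) \<Longrightarrow> Ck k U (\<lambda>x. \<Sum>i\<in>I. f i x)"
  by (induction I rule: infinite_finite_induct) (simp_all add: Ck_const Ck_add del: Ck.simps)

lemma Ck_mult:
  fixes f g :: "'a::euclidean_space \<Rightarrow> real"
  assumes "Ck k U f" "Ck k U g"
  shows "Ck k U (\<lambda>x. f x * g x)"
  using assms
proof (induction k arbitrary: f g)
  case 0
  then show ?case by (auto intro: continuous_intros)
next
  case (Suc k)
  from Suc.prems[unfolded Ck.simps(2)]
  obtain D E where D: "\<forall>x\<in>U. (f has_derivative D x) (at x)" "\<forall>v\<in>Basis. Ck k U (\<lambda>x. D x v)"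
    and E: "\<forall>x\<in>U. (g has_derivative E x) (at x)" "\<forall>v\<in>Basis. Ck k U (\<lambda>x. E x v)" by blast
  show ?case
  proof (rule Ck_SucI[where D = "\<lambda>x v. f x * E x v + D x v * g x"])
    fix x assume "x \<in> U"
    then show "((\<lambda>x. f x * g x) has_derivative (\<lambda>v. f x * E x v + D x v * g x)) (at x)"
      using D(1) E(1) by (intro has_derivative_mult) auto
  next
    fix v :: 'a assume "v \<in> Basis"
    then show "Ck k U (\<lambda>x. f x * E x v + D x v * g x)"
      using D(2) E(2) Suc.prems[THEN Ck_mono_Suc] by (intro Ck_add Suc.IH) auto
  qed
qed

lemma Ck_prod:
  fixes f :: "'i \<Rightarrow> 'a::euclidean_space \<Rightarrow> real"
  shows "(\<And>i. i \<in> I \<Longrightarrow> Ck k U (f i)) \<Longrightarrow> Ck k U (\<lambda>x. \<Prod>i\<in>I. f i x)"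
  by (induction I rule: infinite_finite_induct) (simp_all add: Ck_const Ck_mult del: Ck.simps)

lemma Ck_inverse:
  fixes f :: "'a::euclidean_space \<Rightarrow> real"
  assumes "Ck k U f" "\<And>x. x \<in> U \<Longrightarrow> f x \<noteq> 0"
  shows "Ck k U (\<lambda>x. inverse (f x))"
  using assms
proof (induction k arbitrary: f)
  case 0
  then show ?case by (auto intro!: continuous_intros)
next
  case (Suc k)
  from Suc.prems(1)[unfolded Ck.simps(2)]
  obtain D where D: "\<forall>x\<in>U. (f has_derivative D x) (at x)" "\<forall>v\<in>Basis. Ck k U (\<lambda>x. D x v)" by blast
  show ?case
  proof (rule Ck_SucI[where D = "\<lambda>x v. - 1 * (inverse (f x) * D x v * inverse (f x))"])
    fix x assume "x \<in> U"
    then show "((\<lambda>x. inverse (f x)) has_derivative (\<lambda>v. - 1 * (inverse (f x) * D x v * inverse (f x)))) (at x)"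
      using D(1) Suc.prems(2) has_derivative_inverse[where f = f and x = x and S = UNIV and f' = "D x"] by auto
  next
    fix v :: 'a assume "v \<in> Basis"
    then show "Ck k U (\<lambda>x. - 1 * (inverse (f x) * D x v * inverse (f x)))"
      using D(2) Suc.IH[OF Ck_mono_Suc[OF Suc.prems(1)] Suc.prems(2)] by (intro Ck_mult Ck_const) auto
  qed
qed

lemma smooth_on_continuous_on: "smooth_on U f \<Longrightarrow> continuous_on U f"
  unfolding smooth_on_def using Ck_continuous_on by blast

lemma smooth_on_const: "smooth_on U (\<lambda>x. c)"
  by (simp add: smooth_on_def Ck_const del: Ck.simps)

lemma smooth_on_bounded_linear: "bounded_linear h \<Longrightarrow> smooth_on U h"
  by (simp add: smooth_on_def Ck_bounded_linear del: Ck.simps)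

lemma smooth_on_bounded_linear_compose: "bounded_linear h \<Longrightarrow> smooth_on U f \<Longrightarrow> smooth_on U (\<lambda>x. h (f x))"
  by (simp add: smooth_on_def Ck_bounded_linear_compose del: Ck.simps)

lemma smooth_on_add: "smooth_on U f \<Longrightarrow> smooth_on U g \<Longrightarrow> smooth_on U (\<lambda>x. f x + g x)"
  by (simp add: smooth_on_def Ck_add del: Ck.simps)

lemma smooth_on_sum: "(\<And>i. i \<in> I \<Longrightarrow> smooth_on U (f i)) \<Longrightarrow> smooth_on U (\<lambda>x. \<Sum>i\<in>I. f i x)"
  by (simp add: smooth_on_def Ck_sum del: Ck.simps)

lemma smooth_on_mult:
  fixes f g :: "'a::euclidean_space \<Rightarrow> real"
  shows "smooth_on U f \<Longrightarrow> smooth_on U g \<Longrightarrow> smooth_on U (\<lambda>x. f x * g x)"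
  by (simp add: smooth_on_def Ck_mult del: Ck.simps)

lemma smooth_on_diff:
  fixes f g :: "'a::euclidean_space \<Rightarrow> real"
  shows "smooth_on U f \<Longrightarrow> smooth_on U g \<Longrightarrow> smooth_on U (\<lambda>x. f x - g x)"
  using smooth_on_add[of U f "\<lambda>x. - 1 * g x"] smooth_on_mult[of U "\<lambda>x. - 1" g] smooth_on_const[of U "- 1 :: real"]
  by simp

lemma smooth_on_prod:
  fixes f :: "'i \<Rightarrow> 'a::euclidean_space \<Rightarrow> real"
  shows "(\<And>i. i \<in> I \<Longrightarrow> smooth_on U (f i)) \<Longrightarrow> smooth_on U (\<lambda>x. \<Prod>i\<in>I. f i x)"
  by (simp add: smooth_on_def Ck_prod del: Ck.simps)

lemma smooth_on_inverse:
  fixes f :: "'a::euclidean_space \<Rightarrow> real"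
  shows "smooth_on U f \<Longrightarrow> (\<And>x. x \<in> U \<Longrightarrow> f x \<noteq> 0) \<Longrightarrow> smooth_on U (\<lambda>x. inverse (f x))"
  by (simp add: smooth_on_def Ck_inverse del: Ck.simps)

lemma smooth_on_subset:
  assumes "smooth_on U f" "V \<subseteq> U"
  shows "smooth_on V f"
proof -
  have "Ck k U f \<Longrightarrow> Ck k V f" for k
  proof (induction k arbitrary: f)
    case 0
    then show ?case using assms(2) continuous_on_subset by auto
  next
    case (Suc k)
    from Suc.prems[unfolded Ck.simps(2)]
    obtain D where "\<forall>x\<in>U. (f has_derivative D x) (at x)" "\<forall>v\<in>Basis. Ck k U (\<lambda>x. D x v)" by blast
    then show ?case using assms(2) by (intro Ck_SucI[where D = D] Suc.IH) auto
  qed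
  then show ?thesis using assms(1) unfolding smooth_on_def by blast
qed

lemma smooth_on_nth: "smooth_on U f \<Longrightarrow> smooth_on U (\<lambda>x. f x $ i)"
  by (rule smooth_on_bounded_linear_compose[OF bounded_linear_vec_nth])

lemma smooth_on_vec:
  fixes f :: "'a::euclidean_space \<Rightarrow> real^'n"
  assumes "\<And>i. smooth_on U (\<lambda>x. f x $ i)"
  shows "smooth_on U f"
proof -
  have "smooth_on U (\<lambda>x. \<Sum>i\<in>UNIV. f x $ i *\<^sub>R axis i (1::real))"
    by (intro smooth_on_sum smooth_on_bounded_linear_compose[OF bounded_linear_scaleR_left] assms)
  then show ?thesis by (simp add: basis_expansion flip: scalar_mult_eq_scaleR)
qed

lemma smooth_on_det:
  fixes M :: "'a::euclidean_space \<Rightarrow> real^'n^'n"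
  assumes "\<And>i j. smooth_on U (\<lambda>x. M x $ i $ j)"
  shows "smooth_on U (\<lambda>x. det (M x))"
  unfolding det_def
  by (intro smooth_on_sum smooth_on_mult smooth_on_const smooth_on_prod assms)

text \<open>The solution of a linear system with smooth data is a quotient of determinants, hence
  smooth wherever the system is regular.\<close>

lemma smooth_on_cramer:
  fixes M :: "'a::euclidean_space \<Rightarrow> real^'n^'n" and b :: "'a \<Rightarrow> real^'n"
  assumes "\<And>i j. smooth_on U (\<lambda>x. M x $ i $ j)" "\<And>i. smooth_on U (\<lambda>x. b x $ i)"
    and "\<And>x. x \<in> U \<Longrightarrow> det (M x) \<noteq> 0"
  shows "smooth_on U (\<lambda>x. \<chi> k. det (\<chi> i j. if j = k then b x $ i else M x $ i $ j) / det (M x))"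
proof (rule smooth_on_vec)
  fix k
  have "smooth_on U (\<lambda>x. (\<chi> i j. if j = k then b x $ i else M x $ i $ j) $ i $ j)" for i j
    using assms by (cases "j = k") auto
  then show "smooth_on U (\<lambda>x. (\<chi> k. det (\<chi> i j. if j = k then b x $ i else M x $ i $ j) / det (M x)) $ k)"
    by (simp add: divide_inverse smooth_on_mult smooth_on_inverse smooth_on_det assms)
qed

lemma smooth_on_qmult:
  assumes "smooth_on U F" "smooth_on U G"
  shows "smooth_on U (\<lambda>x. qmult (F x) (G x))"
proof (rule smooth_on_vec)
  fix i
  have "\<forall>i. smooth_on U (\<lambda>x. qmult (F x) (G x) $ i)"
    unfolding forall_4 qmult_nth
    by (intro conjI smooth_on_add smooth_on_diff smooth_on_mult smooth_on_nth assms)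
  then show "smooth_on U (\<lambda>x. qmult (F x) (G x) $ i)" by blast
qed

lemma smooth_on_qinv:
  assumes "smooth_on U F" "\<And>x. x \<in> U \<Longrightarrow> F x \<noteq> 0"
  shows "smooth_on U (\<lambda>x. qinv (F x))"
proof (rule smooth_on_vec)
  fix i
  have n: "smooth_on U (\<lambda>x. inverse (F x \<bullet> F x))"
    unfolding inner_vec_def inner_real_def
    by (intro smooth_on_inverse smooth_on_sum smooth_on_mult smooth_on_nth assms)
      (use assms(2) in \<open>simp flip: inner_vec_def inner_real_def\<close>)
  have "linear qconj" by (auto intro!: linearI simp: vec4_eq_iff qconj_nth)
  then have "bounded_linear qconj" by (simp add: linear_conv_bounded_linear)
  then have "smooth_on U (\<lambda>x. inverse (F x \<bullet> F x) * qconj (F x) $ i)"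
    by (intro smooth_on_mult n smooth_on_nth smooth_on_bounded_linear_compose[of qconj] assms)
  then show "smooth_on U (\<lambda>x. qinv (F x) $ i)"
    by (simp add: qinv_def divide_inverse power2_norm_eq_inner)
qed

section \<open>Rectification\<close>

text \<open>The image of the circle runs inside a line through 0 with nonzero velocity A w, so by
  the intermediate value theorem it covers a neighbourhood of 0 on that line; \<psi> carries this
  back to the circle.\<close>

lemma rectified_ray_in_circle:
  assumes dif: "diffeo_on U V \<phi> \<psi>" and \<phi>0: "\<phi> 0 = 0" and A: "(\<phi> has_derivative A) (at 0)"
    and \<gamma>: "circle_curve \<gamma>" "\<gamma> t0 = 0" "(\<gamma> has_vector_derivative w) (at t0)"
    and nz: "A w \<noteq> 0"
    and L: "is_line L" "\<epsilon> > 0" "ball 0 \<epsilon> \<subseteq> U" "\<phi> ` (range \<gamma> \<inter> ball 0 \<epsilon>) \<subseteq> L"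
  shows "\<forall>\<^sub>F \<tau> in nhds 0. \<psi> (\<tau> *\<^sub>R A w) \<in> range \<gamma>"
proof -
  have \<psi>\<phi>: "\<And>x. x \<in> U \<Longrightarrow> \<psi> (\<phi> x) = x" and sm: "smooth_on U \<phi>"
    using dif by (auto simp: diffeo_on_def)
  have cont: "continuous_on UNIV \<gamma>" by (rule circle_curve_continuous[OF \<gamma>(1)])
  have "open (\<gamma> -` ball 0 \<epsilon>)"
    using cont by (intro open_vimage) auto
  then have near: "\<forall>\<^sub>F t in nhds t0. \<gamma> t \<in> ball 0 \<epsilon>"
    using eventually_nhds_in_open[of "\<gamma> -` ball 0 \<epsilon>" t0] \<gamma>(2) L(2) by simp
  then obtain \<delta> where \<delta>: "\<delta> > 0" "\<And>t. \<bar>t - t0\<bar> < \<delta> \<Longrightarrow> \<gamma> t \<in> ball 0 \<epsilon>"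
    by (auto simp: eventually_nhds_metric dist_real_def)
  obtain p e where e: "e \<noteq> 0" "L = range (line_param p e)"
    using L(1) by (auto simp: is_line_def)
  \<comment> \<open>The line contains the image of the origin, so its base point is a multiple of
    its direction e.\<close>
  have "\<phi> (\<gamma> t0) \<in> L" using L \<gamma>(2) by (metis IntI centre_in_ball image_subset_iff rangeI)
  then obtain s0 where "0 = p + s0 *\<^sub>R e"
    using \<phi>0 \<gamma>(2) e(2) by (auto simp: line_param_def)
  then have p: "p = - (s0 *\<^sub>R e)" by (simp add: eq_neg_iff_add_eq_0)
  have onL: "\<exists>s. \<phi> (\<gamma> t) = s *\<^sub>R e" if "\<gamma> t \<in> ball 0 \<epsilon>" for t
  proof -
    have "\<phi> (\<gamma> t) \<in> L" using that L(4) by blast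
    then obtain s where "\<phi> (\<gamma> t) = p + s *\<^sub>R e" by (auto simp: e(2) line_param_def)
    then have "\<phi> (\<gamma> t) = (s - s0) *\<^sub>R e" by (simp add: p algebra_simps)
    then show ?thesis by blast
  qed
  define d where "d = A w"
  interpret A: bounded_linear A by (rule has_derivative_bounded_linear[OF A])
  have vd: "((\<lambda>t. \<phi> (\<gamma> t)) has_vector_derivative d) (at t0)"
  proof -
    have "(\<gamma> has_derivative (\<lambda>h. h *\<^sub>R w)) (at t0)" using \<gamma>(3) by (simp add: has_vector_derivative_def)
    from has_derivative_compose[OF this, of \<phi> A]
    show ?thesis using A \<gamma>(2) by (simp add: has_vector_derivative_def A.scaleR d_def)
  qed
  define k where "k t = (\<phi> (\<gamma> t) \<bullet> e) / (e \<bullet> e)" for t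
  have \<phi>k: "\<phi> (\<gamma> t) = k t *\<^sub>R e" if "\<gamma> t \<in> ball 0 \<epsilon>" for t
    using onL[OF that] e(1) by (auto simp: k_def)
  have kd: "(k has_real_derivative (d \<bullet> e) / (e \<bullet> e)) (at t0)"
  proof -
    have "((\<lambda>t. \<phi> (\<gamma> t) \<bullet> e) has_vector_derivative d \<bullet> e) (at t0)"
      by (rule bounded_linear.has_vector_derivative[OF bounded_linear_inner_left vd])
    then show ?thesis
      unfolding k_def by (intro DERIV_cdivide) (simp add: has_real_derivative_iff_has_vector_derivative)
  qed
  \<comment> \<open>Differentiating the coordinate form and comparing with the chain rule shows that
    the velocity d is a multiple of e.\<close>
  have "((\<lambda>t. k t *\<^sub>R e) has_vector_derivative ((d \<bullet> e) / (e \<bullet> e)) *\<^sub>R e) (at t0)"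
    using has_vector_derivative_scaleR[OF kd has_vector_derivative_const[of e]] by simp
  then have "((\<lambda>t. \<phi> (\<gamma> t)) has_vector_derivative ((d \<bullet> e) / (e \<bullet> e)) *\<^sub>R e) (at t0)"
    by (rule has_vector_derivative_transform_within[OF _ \<delta>(1)]) (auto simp: dist_real_def intro!: \<phi>k[symmetric] \<delta>(2))
  then have "((d \<bullet> e) / (e \<bullet> e)) *\<^sub>R e = d"
    by (rule vector_derivative_unique_at) (rule vd)
  then obtain c where c: "d = c *\<^sub>R e" by metis
  then have c0: "c \<noteq> 0" using nz by (auto simp: d_def)
  \<comment> \<open>The coordinate rescaled from e to d, so that its derivative at t0 is 1.\<close>
  define h where "h t = k t / c" for t
  have \<phi>h: "\<phi> (\<gamma> t) = h t *\<^sub>R d" if "\<bar>t - t0\<bar> < \<delta>" for t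
    using \<phi>k[OF \<delta>(2)[OF that]] c c0 by (simp add: h_def)
  have hd: "(h has_real_derivative 1) (at t0)"
    using DERIV_cdivide[OF kd, of c] c c0 e(1) unfolding h_def by simp
  have h0: "h t0 = 0" using \<gamma>(2) \<phi>0 by (simp add: h_def k_def)
  \<comment> \<open>The positive derivative at the single point t0 gives values of both signs
    nearby; continuity fills the interval between them.\<close>
  obtain d1 where d1: "d1 > 0" "\<And>s. 0 < s \<Longrightarrow> s < d1 \<Longrightarrow> h t0 < h (t0 + s)"
    using DERIV_pos_inc_right[OF hd] by auto
  obtain d2 where d2: "d2 > 0" "\<And>s. 0 < s \<Longrightarrow> s < d2 \<Longrightarrow> h (t0 - s) < h t0"
    using DERIV_pos_inc_left[OF hd] by auto
  define \<eta> where "\<eta> = min \<delta> (min d1 d2) / 2"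
  have \<eta>: "\<eta> > 0" "\<eta> < \<delta>" "\<eta> < d1" "\<eta> < d2" using \<delta>(1) d1(1) d2(1) by (auto simp: \<eta>_def)
  have conth: "continuous_on {t0 - \<eta>..t0 + \<eta>} h"
  proof -
    have "continuous_on {t0 - \<eta>..t0 + \<eta>} (\<lambda>t. \<phi> (\<gamma> t))"
    proof (rule continuous_on_compose2[OF smooth_on_continuous_on[OF sm]])
      show "continuous_on {t0 - \<eta>..t0 + \<eta>} \<gamma>" using cont continuous_on_subset by blast
      show "\<gamma> ` {t0 - \<eta>..t0 + \<eta>} \<subseteq> U" using \<delta>(2) L(3) \<eta>(2) by (auto simp: image_subset_iff abs_if subset_iff)
    qed
    then show ?thesis unfolding h_def k_def by (intro continuous_intros) (use c0 e(1) in auto)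
  qed
  have "\<psi> (\<tau> *\<^sub>R A w) \<in> range \<gamma>" if \<tau>: "h (t0 - \<eta>) < \<tau>" "\<tau> < h (t0 + \<eta>)" for \<tau>
  proof -
    obtain t where t: "t \<in> {t0 - \<eta>..t0 + \<eta>}" "h t = \<tau>"
      using IVT'[of h "t0 - \<eta>" \<tau> "t0 + \<eta>"] \<tau> conth \<eta>(1) by auto
    then have td: "\<bar>t - t0\<bar> < \<delta>" using \<eta>(2) by auto
    have "\<psi> (\<tau> *\<^sub>R A w) = \<gamma> t"
      using \<phi>h[OF td] \<psi>\<phi>[of "\<gamma> t"] \<delta>(2)[OF td] L(3) t(2) by (auto simp: d_def)
    then show ?thesis by blast
  qed
  moreover have "\<forall>\<^sub>F \<tau> in nhds 0. \<tau> \<in> {h (t0 - \<eta>)<..<h (t0 + \<eta>)}"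
    using d1(2)[of \<eta>] d2(2)[of \<eta>] h0 \<eta> by (intro eventually_nhds_in_open) auto
  ultimately show ?thesis by (auto elim: eventually_mono)
qed

lemma smooth_on_has_derivative:
  assumes "smooth_on U f" "x \<in> U"
  shows "\<exists>D. (f has_derivative D) (at x)"
proof -
  have "Ck (Suc 0) U f" using assms(1) unfolding smooth_on_def by blast
  then show ?thesis using assms(2) unfolding Ck.simps(2) by blast
qed

lemma hom_poly_inner:
  assumes "\<And>b. hom_poly d (\<lambda>x. F x $ b)" "\<And>b. hom_poly e (\<lambda>x. G x $ b)"
  shows "hom_poly (d + e) (\<lambda>x. F x \<bullet> G x)"
  unfolding inner_vec_def inner_real_def by (intro hom_poly_sum hom_poly_mult assms)

lemma hom_poly_wedge:
  assumes "\<And>b. hom_poly d (\<lambda>x. F x $ b)"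
  shows "hom_poly (d + 1) (\<lambda>x. wedge (F x) x i j)"
  unfolding wedge_def by (intro hom_poly_diff hom_poly_mult hom_poly_nth assms)

text \<open>Q is the second-order Taylor term of the inverse rectification. Modulo the tangent
  vector it prescribes the m of every circle of S, and the higher terms enter only through the two
  divisibilities.\<close>

lemma rectifiable_bundle_quadratic:
  assumes dense: "zariski_dense (tangent_dirs S)" and rect: "rectifiable S"
  obtains Q where "\<And>b. hom_poly 2 (\<lambda>x. Q x $ b)" "norm_dvd (\<lambda>x. x \<bullet> Q x)" "norm_dvd (\<lambda>x. Q x \<bullet> Q x)"
    "\<And>C. C \<in> S \<Longrightarrow> is_circle C \<Longrightarrow> 0 \<in> C \<Longrightarrow> \<exists>x m k. x \<noteq> 0 \<and>
       (\<forall>p\<in>C. \<exists>s. p = (p \<bullet> p) *\<^sub>R m + s *\<^sub>R x) \<and> Q x = (x \<bullet> x) *\<^sub>R m + k *\<^sub>R x"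
proof -
  from rect[unfolded rectifiable_def] obtain \<phi> \<psi> U V where
    r: "0 \<in> U \<and> diffeo_on U V \<phi> \<psi> \<and> \<phi> 0 = 0 \<and>
     (\<forall>C\<in>S. \<exists>L \<epsilon>. is_line L \<and> \<epsilon> > 0 \<and> ball 0 \<epsilon> \<subseteq> U \<and> \<phi> ` (C \<inter> ball 0 \<epsilon>) \<subseteq> L)"
    by (elim exE)
  then have U0: "0 \<in> U" and dif: "diffeo_on U V \<phi> \<psi>" and \<phi>0: "\<phi> 0 = 0"
    and lines: "\<And>C. C \<in> S \<Longrightarrow> \<exists>L \<epsilon>. is_line L \<and> \<epsilon> > 0 \<and> ball 0 \<epsilon> \<subseteq> U \<and> \<phi> ` (C \<inter> ball 0 \<epsilon>) \<subseteq> L"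
    by simp_all
  have opn: "open U" "open V" and \<psi>\<phi>: "\<And>x. x \<in> U \<Longrightarrow> \<psi> (\<phi> x) = x"
    and sm: "smooth_on U \<phi>" "smooth_on V \<psi>" and \<phi>U: "\<phi> ` U = V"
    using dif unfolding diffeo_on_def by blast+
  have V0: "0 \<in> V" using imageI[OF U0, of \<phi>] \<phi>0 \<phi>U by simp
  have \<psi>0: "\<psi> 0 = 0" using \<psi>\<phi>[OF U0] \<phi>0 by simp
  obtain A where A: "(\<phi> has_derivative A) (at 0)" using smooth_on_has_derivative[OF sm(1) U0] by blast
  obtain B where B: "(\<psi> has_derivative B) (at 0)" using smooth_on_has_derivative[OF sm(2) V0] by blast
  \<comment> \<open>The chain rule for \<psi> after \<phi>; it makes A injective and the linear
    Taylor term the identity.\<close>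
  have BA: "B (A x) = x" for x
  proof -
    have "((\<lambda>x. \<psi> (\<phi> x)) has_derivative (\<lambda>x. B (A x))) (at 0)"
      using has_derivative_compose[OF A, of \<psi> B] B \<phi>0 by simp
    then have "((\<lambda>x. x) has_derivative (\<lambda>x. B (A x))) (at 0)"
      by (rule has_derivative_transform_within_open[OF _ opn(1) U0]) (simp add: \<psi>\<phi>)
    then have "(\<lambda>x. B (A x)) = (\<lambda>x. x)"
      using has_derivative_unique has_derivative_ident by blast
    then show ?thesis by metis
  qed
  have linA: "linear A" using has_derivative_bounded_linear[OF A] by (simp add: linear_conv_bounded_linear)
  have linB: "linear B" using has_derivative_bounded_linear[OF B] by (simp add: linear_conv_bounded_linear)
  have Anz: "A x \<noteq> 0" if "x \<noteq> 0" for x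
    using BA[of x] linear_0[OF linB] that by auto
  \<comment> \<open>Order four is what the third identity of \<open>circle_jet\<close>
    requires.\<close>
  have Ck4: "Ck 4 V \<psi>" using sm(2) unfolding smooth_on_def by blast
  from Ck_taylor_rays[OF opn(2) V0 linA Ck4]
  obtain P where P: "\<And>i b. hom_poly i (\<lambda>x. P i x $ b)" "\<And>x. P 0 x = \<psi> 0"
    "\<And>x f'. (0::nat) < 4 \<Longrightarrow> (\<psi> has_derivative f') (at 0) \<Longrightarrow> P 1 x = f' (A x)"
    "\<And>x. ((\<lambda>t. (\<psi> (t *\<^sub>R A x) - (\<Sum>i\<le>4. t ^ i *\<^sub>R P i x)) /\<^sub>R t ^ 4) \<longlongrightarrow> 0) (at 0)"
    by blast
  have P1: "P 1 x = x" for x using P(3)[OF _ B] BA by simp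
  let ?Q = "P 2" and ?K = "P 3" and ?M = "P 4"
  have tay: "((\<lambda>t. (\<psi> (t *\<^sub>R A x) - (t *\<^sub>R x + t^2 *\<^sub>R ?Q x + t^3 *\<^sub>R ?K x + t^4 *\<^sub>R ?M x)) /\<^sub>R t ^ 4) \<longlongrightarrow> 0) (at 0)" for x
  proof -
    have s4: "(\<Sum>i\<le>4. f i) = f 0 + f 1 + f 2 + f 3 + f 4" for f :: "nat \<Rightarrow> real^4"
      by (simp add: eval_nat_numeral)
    show ?thesis using P(4)[of x] unfolding s4 by (simp add: P(2) \<psi>0 P1[unfolded One_nat_def])
  qed
  have jet: "\<exists>m. (\<forall>p\<in>C. \<exists>s. p = (p \<bullet> p) *\<^sub>R m + s *\<^sub>R w) \<and> w \<noteq> 0 \<and>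
      (\<forall>i j. wedge (?Q w) w i j = (w \<bullet> w) * wedge m w i j \<and>
        wedge (?K w) w i j = 2 * (w \<bullet> ?Q w) * wedge m w i j \<and>
        wedge (?M w) w i j = (?Q w \<bullet> ?Q w + 2 * (w \<bullet> ?K w)) * wedge m w i j)"
    if C: "C \<in> S" "circle_curve \<gamma>" "C = range \<gamma>" "\<gamma> t0 = 0" "(\<gamma> has_vector_derivative w) (at t0)" for C \<gamma> t0 w
  proof -
    obtain m where w: "w \<noteq> 0" and m: "\<forall>t. \<exists>s. \<gamma> t = (\<gamma> t \<bullet> \<gamma> t) *\<^sub>R m + s *\<^sub>R w"
      using circle_curve_through_0[OF C(2,4,5)] by blast
    obtain L \<epsilon> where L: "is_line L" "\<epsilon> > 0" "ball 0 \<epsilon> \<subseteq> U" "\<phi> ` (range \<gamma> \<inter> ball 0 \<epsilon>) \<subseteq> L"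
      using lines[OF C(1)] unfolding C(3) by blast
    have "\<forall>\<^sub>F \<tau> in nhds 0. \<psi> (\<tau> *\<^sub>R A w) \<in> range \<gamma>"
      by (rule rectified_ray_in_circle[OF dif \<phi>0 A C(2,4,5) Anz[OF w] L])
    then have "\<forall>\<^sub>F \<tau> in at 0. \<psi> (\<tau> *\<^sub>R A w) \<in> range \<gamma>"
      by (simp add: eventually_nhds_conv_at)
    then have "\<forall>\<^sub>F \<tau> in at 0. \<exists>s. \<psi> (\<tau> *\<^sub>R A w) = (\<psi> (\<tau> *\<^sub>R A w) \<bullet> \<psi> (\<tau> *\<^sub>R A w)) *\<^sub>R m + s *\<^sub>R w"
      by (rule eventually_mono) (use m in auto)
    from circle_jet[OF tay this] show ?thesis
      using m w unfolding C(3) by blast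
  qed
  \<comment> \<open>An identity forced by the jets holds at tangent vectors, by homogeneity on the
    tangent lines, and by density everywhere.\<close>
  have fromD: "f x = 0" if f: "hom_poly d f" and
    z: "\<And>w m. (\<And>i j. wedge (?Q w) w i j = (w \<bullet> w) * wedge m w i j) \<Longrightarrow>
        (\<And>i j. wedge (?K w) w i j = 2 * (w \<bullet> ?Q w) * wedge m w i j) \<Longrightarrow>
        (\<And>i j. wedge (?M w) w i j = (?Q w \<bullet> ?Q w + 2 * (w \<bullet> ?K w)) * wedge m w i j) \<Longrightarrow> f w = 0" for d f x
  proof (rule zariski_dense_hom_poly_zero[OF dense f])
    fix L x assume "L \<in> tangent_dirs S" "x \<in> L"
    then obtain C \<gamma> t0 w where C: "C \<in> S" "circle_curve \<gamma>" "C = range \<gamma>" "\<gamma> t0 = 0"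
        "(\<gamma> has_vector_derivative w) (at t0)" and "x \<in> span {w}"
      unfolding tangent_dirs_def tangent_line0_def by blast
    then obtain c where x: "x = c *\<^sub>R w" by (auto simp: span_singleton)
    have "f w = 0" using jet[OF C] z by blast
    then show "f x = 0" using hom_poly_homogeneous[OF f] x by simp
  qed
  have xx: "hom_poly 2 (\<lambda>x::real^4. x \<bullet> x)"
    using hom_poly_inner[OF hom_poly_nth hom_poly_nth] by (simp add: numeral_2_eq_2)
  \<comment> \<open>At a tangent vector, replacing |x|^2 (m \<and> x) by Q \<and> x eliminates m.
    Both sides have degree 6; in I2 below both have degree 7.\<close>
  have I1: "(x \<bullet> x) * wedge (?K x) x i j = 2 * (x \<bullet> ?Q x) * wedge (?Q x) x i j" for x i j
  proof -
    have "hom_poly (2 + (3 + 1)) (\<lambda>x. (x \<bullet> x) * wedge (?K x) x i j)"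
      by (intro hom_poly_mult xx hom_poly_wedge P)
    moreover have "hom_poly ((1 + 2) + (2 + 1)) (\<lambda>x. (x \<bullet> ?Q x) * wedge (?Q x) x i j)"
      by (intro hom_poly_mult hom_poly_inner hom_poly_wedge P hom_poly_nth)
    ultimately have h: "hom_poly 6 (\<lambda>x. (x \<bullet> x) * wedge (?K x) x i j - 2 * ((x \<bullet> ?Q x) * wedge (?Q x) x i j))"
      by (intro hom_poly_diff hom_poly_scale) (simp_all add: numeral_eq_Suc)
    have "(x \<bullet> x) * wedge (?K x) x i j - 2 * ((x \<bullet> ?Q x) * wedge (?Q x) x i j) = 0"
      by (rule fromD[OF h]) simp
    then show ?thesis by simp
  qed
  have I2: "(x \<bullet> x) * wedge (?M x) x i j = (?Q x \<bullet> ?Q x + 2 * (x \<bullet> ?K x)) * wedge (?Q x) x i j" for x i j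
  proof -
    have "hom_poly (2 + (4 + 1)) (\<lambda>x. (x \<bullet> x) * wedge (?M x) x i j)"
      by (intro hom_poly_mult xx hom_poly_wedge P)
    then have 1: "hom_poly 7 (\<lambda>x. (x \<bullet> x) * wedge (?M x) x i j)"
      by (simp add: numeral_eq_Suc)
    have "hom_poly (2 + 2) (\<lambda>x. ?Q x \<bullet> ?Q x)" "hom_poly (1 + 3) (\<lambda>x. x \<bullet> ?K x)"
      by (intro hom_poly_inner P hom_poly_nth)+
    then have "hom_poly 4 (\<lambda>x. ?Q x \<bullet> ?Q x + 2 * (x \<bullet> ?K x))"
      by (intro hom_poly_add hom_poly_scale) (simp_all add: numeral_eq_Suc)
    then have "hom_poly (4 + (2 + 1)) (\<lambda>x. (?Q x \<bullet> ?Q x + 2 * (x \<bullet> ?K x)) * wedge (?Q x) x i j)"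
      by (intro hom_poly_mult hom_poly_wedge P)
    then have 2: "hom_poly 7 (\<lambda>x. (?Q x \<bullet> ?Q x + 2 * (x \<bullet> ?K x)) * wedge (?Q x) x i j)"
      by (simp add: numeral_eq_Suc)
    have "(x \<bullet> x) * wedge (?M x) x i j - (?Q x \<bullet> ?Q x + 2 * (x \<bullet> ?K x)) * wedge (?Q x) x i j = 0"
      by (rule fromD[OF hom_poly_diff[OF 1 2]]) simp
    then show ?thesis by simp
  qed
  have Q0: "?Q 0 = 0"
    using hom_poly_homogeneous[OF P(1)[of 2], of 0 0] by (simp add: vec_eq_iff)
  note rpf = hom_poly_imp_real_polynomial_function[OF P(1)]
  have dv: "norm_dvd (\<lambda>x. x \<bullet> ?Q x)" "norm_dvd (\<lambda>x. ?Q x \<bullet> ?Q x)"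
    using norm_dvd_osculating[OF rpf rpf rpf Q0 I1 I2] by blast+
  have "\<exists>x m k. x \<noteq> 0 \<and> (\<forall>p\<in>C. \<exists>s. p = (p \<bullet> p) *\<^sub>R m + s *\<^sub>R x) \<and> ?Q x = (x \<bullet> x) *\<^sub>R m + k *\<^sub>R x"
    if C: "C \<in> S" "is_circle C" "0 \<in> C" for C
  proof -
    obtain \<gamma> t0 where \<gamma>: "circle_curve \<gamma>" "C = range \<gamma>" "\<gamma> t0 = 0"
      using C(2,3) unfolding is_circle_def by (metis imageE)
    obtain w where w: "(\<gamma> has_vector_derivative w) (at t0)"
      using circle_curve_differentiable[OF \<gamma>(1)] by blast
    obtain m where m: "\<forall>p\<in>C. \<exists>s. p = (p \<bullet> p) *\<^sub>R m + s *\<^sub>R w" "w \<noteq> 0"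
      "\<And>i j. wedge (?Q w) w i j = (w \<bullet> w) * wedge m w i j"
      using jet[OF C(1) \<gamma> w] by blast
    \<comment> \<open>The first jet identity says that Q - |w|^2 m has no component transverse to
      w.\<close>
    have "wedge (?Q w + (- (w \<bullet> w)) *\<^sub>R m) w i j = 0" for i j
      unfolding wedge_add wedge_scale using m(3) by simp
    from wedge_zero_imp_parallel[OF this m(2)]
    obtain k where "?Q w + (- (w \<bullet> w)) *\<^sub>R m = k *\<^sub>R w" by blast
    then have "?Q w = (w \<bullet> w) *\<^sub>R m + k *\<^sub>R w" by (simp add: algebra_simps)
    then show ?thesis using m by blast
  qed
  with P(1) dv show thesis by (rule that)
qed

section \<open>The quaternionic quotient map and its inverse\<close>

text \<open>Both orders of the product, hence both forms of \<open>T\<close>, are treated at once.\<close>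

definition sided_qmult :: "(real^4 \<Rightarrow> real^4 \<Rightarrow> real^4) \<Rightarrow> bool" where
  "sided_qmult f \<longleftrightarrow> f = qmult \<or> f = (\<lambda>p q. qmult q p)"

lemma sided_qmult_bilinear: "sided_qmult f \<Longrightarrow> bilinear f"
  using bilinear_qmult by (auto simp: sided_qmult_def bilinear_def)

lemma sided_qmult_one: "sided_qmult f \<Longrightarrow> f (axis 1 1) x = x"
  by (auto simp: sided_qmult_def vec4_eq_iff qmult_nth axis_def)

text \<open>Every quaternion satisfies b^2 = 2 Re(b) b - |b|^2, so multiplication by b preserves the
  span of x and b x.\<close>

lemma sided_qmult_square:
  "sided_qmult f \<Longrightarrow> f b (f b x) = (2 * b$1) *\<^sub>R f b x - (b \<bullet> b) *\<^sub>R x"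
  by (auto simp: sided_qmult_def vec4_eq_iff qmult_nth inner_4 algebra_simps)

lemma sided_qmult_inner:
  assumes "sided_qmult f"
  shows "f b x \<bullet> f b x = (b \<bullet> b) * (x \<bullet> x)" "f b x \<bullet> x = b$1 * (x \<bullet> x)"
  using assms by (auto simp: sided_qmult_def qmult_nth inner_4 algebra_simps)

lemma qmult_qinv: "b \<noteq> 0 \<Longrightarrow> qmult (qinv b) b = axis 1 1" "b \<noteq> 0 \<Longrightarrow> qmult b (qinv b) = axis 1 1"
proof -
  assume b: "b \<noteq> 0"
  have "qmult (qconj b) b = (b \<bullet> b) *\<^sub>R axis 1 1" "qmult b (qconj b) = (b \<bullet> b) *\<^sub>R axis 1 1"
    by (simp_all add: vec4_eq_iff qmult_nth qconj_nth inner_4 axis_def)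
  then show "qmult (qinv b) b = axis 1 1" "qmult b (qinv b) = axis 1 1"
    using b by (simp_all add: qinv_def qmult_simps power2_norm_eq_inner)
qed

lemma sided_qmult_inverse:
  assumes "sided_qmult f" "b \<noteq> 0"
  shows "f (qinv b) (f b x) = x" "f b (f (qinv b) x) = x"
proof -
  have one: "qmult (axis 1 1) x = x" "qmult x (axis 1 1) = x"
    by (simp_all add: vec4_eq_iff qmult_nth axis_def)
  show "f (qinv b) (f b x) = x" "f b (f (qinv b) x) = x"
    using assms qmult_qinv[OF assms(2)] one
    by (auto simp: sided_qmult_def) (metis qmult_assoc)+
qed

lemma smooth_on_sided_qmult:
  "sided_qmult f \<Longrightarrow> smooth_on U F \<Longrightarrow> smooth_on U G \<Longrightarrow> smooth_on U (\<lambda>x. f (F x) (G x))"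
  by (auto simp: sided_qmult_def intro: smooth_on_qmult)

text \<open>The point p lies in the span of x and E = b x, which multiplication by b preserves. The
  vector equation thus becomes two scalar equations for t, and the circle equation makes them
  compatible. The solution puts the preimage of p at t x.\<close>

lemma sided_qmult_circle_solution:
  fixes p x m b :: "real^4"
  assumes f: "sided_qmult f" and x: "x \<noteq> 0" and b: "f b x = (x \<bullet> x) *\<^sub>R m + k *\<^sub>R x"
    and p: "p = (p \<bullet> p) *\<^sub>R m + s *\<^sub>R x" and small: "(p \<bullet> p) * (b \<bullet> b) < x \<bullet> x"
  shows "\<exists>t. t *\<^sub>R x + t *\<^sub>R f b p = p"
proof (cases "p = 0")
  case True
  then show ?thesis by (intro exI[of _ 0]) simp
next
  case False
  interpret fb: linear "f b" using sided_qmult_bilinear[OF f] by (simp add: bilinear_def)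
  define a where "a = (p \<bullet> p) / (x \<bullet> x)"
  define E where "E = f b x"
  define \<sigma> where "\<sigma> = s - a * k"
  have xx: "x \<bullet> x > 0" using x by simp
  have a: "a > 0" "a * (x \<bullet> x) = p \<bullet> p" using x False by (simp_all add: a_def)
  have pE: "p = a *\<^sub>R E + \<sigma> *\<^sub>R x"
  proof -
    have "a *\<^sub>R E + \<sigma> *\<^sub>R x = (a * (x \<bullet> x)) *\<^sub>R m + s *\<^sub>R x"
      by (simp add: E_def b \<sigma>_def algebra_simps)
    then show ?thesis using p a(2) by simp
  qed
  have "p \<bullet> p = a\<^sup>2 * (E \<bullet> E) + 2 * a * \<sigma> * (E \<bullet> x) + \<sigma>\<^sup>2 * (x \<bullet> x)"
    unfolding pE by (simp add: inner_add_left inner_add_right inner_commute power2_eq_square algebra_simps)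
  also have "\<dots> = (a\<^sup>2 * (b \<bullet> b) + 2 * a * \<sigma> * b$1 + \<sigma>\<^sup>2) * (x \<bullet> x)"
    unfolding E_def sided_qmult_inner[OF f] by (simp add: algebra_simps)
  \<comment> \<open>The circle equation in the coordinates (a, \<sigma>) of p, from |p|^2 = a
    |x|^2.\<close>
  finally have key: "a = a\<^sup>2 * (b \<bullet> b) + 2 * a * \<sigma> * b$1 + \<sigma>\<^sup>2"
    using a(2) xx by simp
  \<comment> \<open>D is the coefficient of E in b p. The two equations are t D = a and t (1 - a
    |b|^2) = \<sigma>; D = 0 would force a |b|^2 = 1, which the smallness of p excludes.\<close>
  define D where "D = 2 * a * b$1 + \<sigma>"
  have D: "D \<noteq> 0"
  proof
    assume "D = 0"
    then have "\<sigma> = - (2 * a * b$1)" by (simp add: D_def)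
    then have "a = a * (a * (b \<bullet> b))" using key by (simp add: power2_eq_square algebra_simps)
    then have "a * (b \<bullet> b) = 1" using a(1) by simp
    then have "(p \<bullet> p) * (b \<bullet> b) = x \<bullet> x" using xx by (simp add: a_def field_simps)
    then show False using small by simp
  qed
  define t where "t = a / D"
  have t: "t * D = a" using D by (simp add: t_def)
  \<comment> \<open>By \<open>key\<close>, the value a / D found from the first equation also solves
    the second.\<close>
  have "\<sigma> * D = a * (1 - a * (b \<bullet> b))"
    unfolding D_def using key by (simp add: power2_eq_square algebra_simps)
  also have "\<dots> = t * (1 - a * (b \<bullet> b)) * D" by (simp flip: t)
  finally have "\<sigma> * D = t * (1 - a * (b \<bullet> b)) * D" .
  then have \<sigma>: "\<sigma> = t * (1 - a * (b \<bullet> b))" using D by simp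
  have fp: "f b p = D *\<^sub>R E - (a * (b \<bullet> b)) *\<^sub>R x"
    unfolding pE D_def by (simp add: fb.add fb.scale E_def sided_qmult_square[OF f] algebra_simps)
  have "t *\<^sub>R x + t *\<^sub>R f b p = (t * D) *\<^sub>R E + (t * (1 - a * (b \<bullet> b))) *\<^sub>R x"
    unfolding fp by (simp add: algebra_simps)
  also have "\<dots> = p" unfolding t \<sigma>[symmetric] pE[symmetric] ..
  finally show ?thesis by blast
qed

text \<open>The map \<open>T x = (1 - \<beta> x)\<^sup>-\<^sup>1 x\<close> is inverted by solving \<open>z + \<beta>(z) y = y\<close>, which is linear in
  \<open>z\<close>, so Cramer's rule gives a rational, hence smooth, inverse.\<close>

lemma sided_quotient_diffeo:
  fixes \<beta> :: "real^4 \<Rightarrow> real^4"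
  assumes f: "sided_qmult f" and \<beta>: "linear \<beta>"
  defines "T \<equiv> \<lambda>x. f (qinv (axis 1 1 - \<beta> x)) x"
  shows "\<exists>U V g. 0 \<in> U \<and> 0 \<in> V \<and> diffeo_on U V T g \<and> (\<forall>y\<in>V. \<forall>z. z + f (\<beta> z) y = y \<longrightarrow> g y = z)"
proof -
  note bil = sided_qmult_bilinear[OF f]
  note bs = bilinear_ladd[OF bil] bilinear_lmul[OF bil] bilinear_lsub[OF bil] bilinear_lzero[OF bil] bilinear_rzero[OF bil]
  have \<beta>0: "\<beta> 0 = 0" by (rule linear_0[OF \<beta>])
  define M where "M y = matrix (\<lambda>z. z + f (\<beta> z) y)" for y
  have Mv: "M y *v z = z + f (\<beta> z) y" for y z
  proof -
    have "linear (\<lambda>z. z + f (\<beta> z) y)"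
      by (rule linearI) (simp_all add: linear_add[OF \<beta>] linear_cmul[OF \<beta>] bs algebra_simps)
    then show ?thesis unfolding M_def by (simp add: matrix_vector_mul)
  qed
  \<comment> \<open>Cramer's formula for the solution z of z + \<beta>(z) y = y.\<close>
  define g where "g y = (\<chi> k. det (\<chi> i j. if j = k then y $ i else M y $ i $ j) / det (M y))" for y
  define U0 where "U0 = {x. axis 1 1 - \<beta> x \<noteq> 0}"
  define V0 where "V0 = {y. det (M y) \<noteq> 0}"
  have g: "z + f (\<beta> z) y = y \<longleftrightarrow> z = g y" if "y \<in> V0" for y z
    using cramer[of "M y" z y] that unfolding V0_def g_def Mv by simp
  have id: "smooth_on W (\<lambda>x::real^4. x)" for W by (rule smooth_on_bounded_linear) simp
  have bl: "bounded_linear \<beta>" using \<beta> by (simp add: linear_conv_bounded_linear)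
  have sB: "smooth_on W (\<lambda>x. axis 1 1 - \<beta> x)" for W
  proof -
    have "smooth_on W (\<lambda>x. axis 1 1 + - \<beta> x)"
      by (intro smooth_on_add smooth_on_const smooth_on_bounded_linear bounded_linear_minus bl)
    then show ?thesis by simp
  qed
  have sM: "smooth_on W (\<lambda>y. M y $ i $ j)" for W i j
  proof -
    have "smooth_on W (\<lambda>y. (axis j 1 + f (\<beta> (axis j 1)) y) $ i)"
      by (intro smooth_on_nth smooth_on_add smooth_on_const smooth_on_sided_qmult[OF f] id)
    then show ?thesis by (simp add: M_def matrix_def)
  qed
  have sT: "smooth_on U0 T"
    unfolding T_def by (intro smooth_on_sided_qmult[OF f] smooth_on_qinv sB id) (simp add: U0_def)
  have sg: "smooth_on V0 g"
    unfolding g_def by (rule smooth_on_cramer) (auto simp: V0_def sM id smooth_on_nth)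
  have oU0: "open U0"
    unfolding U0_def using smooth_on_continuous_on[OF sB, of UNIV]
    by (intro open_Collect_neq) (auto intro: continuous_intros)
  have oV0: "open V0"
    unfolding V0_def using smooth_on_continuous_on[OF smooth_on_det[OF sM], of UNIV]
    by (intro open_Collect_neq) (auto intro: continuous_intros)
  \<comment> \<open>Each regular domain is cut down to points whose image is regular for the other
    map, so that T and g become mutually inverse.\<close>
  define U where "U = U0 \<inter> T -` V0"
  define V where "V = V0 \<inter> g -` U0"
  have oU: "open U" unfolding U_def
    by (intro continuous_open_preimage smooth_on_continuous_on sT oU0 oV0)
  have oV: "open V" unfolding V_def
    by (intro continuous_open_preimage smooth_on_continuous_on sg oU0 oV0)
  \<comment> \<open>T x solves (1 - \<beta> x) y = x for y; the same equation, solved for x, is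
    linear and defines g.\<close>
  have T: "x + f (\<beta> x) (T x) = T x" if "x \<in> U0" for x
  proof -
    have "f (axis 1 1 - \<beta> x) (T x) = x"
      unfolding T_def using that by (intro sided_qmult_inverse[OF f]) (simp add: U0_def)
    then show ?thesis by (simp add: bs sided_qmult_one[OF f] algebra_simps)
  qed
  have gT: "g (T x) = x" if "x \<in> U" for x
    using T[of x] g[of "T x" x] that by (auto simp: U_def)
  have Tg: "T (g y) = y" if "y \<in> V" for y
  proof -
    have 1: "g y + f (\<beta> (g y)) y = y" and 2: "axis 1 1 - \<beta> (g y) \<noteq> 0"
      using that g[of y "g y"] by (auto simp: V_def U0_def)
    have "f (axis 1 1 - \<beta> (g y)) y = y - f (\<beta> (g y)) y"
      by (simp add: bs sided_qmult_one[OF f])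
    also have "\<dots> = g y" using 1 by (simp add: algebra_simps)
    finally have "T (g y) = f (qinv (axis 1 1 - \<beta> (g y))) (f (axis 1 1 - \<beta> (g y)) y)"
      by (simp add: T_def)
    then show ?thesis using sided_qmult_inverse(1)[OF f 2] by simp
  qed
  have TU: "T x \<in> V" if "x \<in> U" for x
    using that gT[OF that] by (auto simp: U_def V_def)
  have gV: "g y \<in> U" if "y \<in> V" for y
    using that Tg[OF that] by (auto simp: U_def V_def)
  have "T ` U = V"
    using TU gV image_eqI[of _ T "g _" U, OF Tg[symmetric]] by blast
  moreover have "g ` V = U"
    using TU gV image_eqI[of _ g "T _" V, OF gT[symmetric]] by blast
  ultimately have diff: "diffeo_on U V T g"
    unfolding diffeo_on_def using oU oV gT Tg smooth_on_subset[OF sT, of U] smooth_on_subset[OF sg, of V]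
    by (auto simp: U_def V_def)
  \<comment> \<open>At y = 0 the linear map in z is the identity, with determinant one.\<close>
  have "0 \<in> V0"
    by (simp add: V0_def M_def bs matrix_id_mat_1[unfolded id_def])
  moreover have T0: "T 0 = 0" by (simp add: T_def bs)
  moreover have "0 \<in> U0" by (simp add: U0_def \<beta>0 axis_eq_0_iff)
  ultimately have "0 \<in> U" by (simp add: U_def)
  moreover have "0 \<in> V" using TU[OF \<open>0 \<in> U\<close>] T0 by simp
  moreover have "g y = z" if "y \<in> V" "z + f (\<beta> z) y = y" for y z
    using g[of y z] that by (simp add: V_def)
  ultimately show ?thesis using diff by blast
qed

theorem theorem3:
  fixes S :: "(real^4) set set"
  assumes "simple_bundle S"
    and "zariski_dense (tangent_dirs S)"
    and "rectifiable S"
  shows "\<exists>A B T. affine_map A \<and> affine_map B \<and>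
     (T = (\<lambda>x. qmult (qinv (B x)) (A x)) \<or> T = (\<lambda>x. qmult (A x) (qinv (B x)))) \<and>
     T 0 = 0 \<and>
     (\<exists>U V g. 0 \<in> U \<and> diffeo_on U V T g \<and>
        (\<forall>C\<in>S. \<exists>L \<epsilon>. is_line L \<and> \<epsilon> > 0 \<and> ball 0 \<epsilon> \<subseteq> V \<and> g ` (C \<inter> ball 0 \<epsilon>) \<subseteq> L))"
proof -
  obtain Q where Q: "\<And>b. hom_poly 2 (\<lambda>x. Q x $ b)" "norm_dvd (\<lambda>x. x \<bullet> Q x)" "norm_dvd (\<lambda>x. Q x \<bullet> Q x)"
    and QC: "\<And>C. C \<in> S \<Longrightarrow> is_circle C \<Longrightarrow> 0 \<in> C \<Longrightarrow> \<exists>x m k. x \<noteq> 0 \<and>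
       (\<forall>p\<in>C. \<exists>s. p = (p \<bullet> p) *\<^sub>R m + s *\<^sub>R x) \<and> Q x = (x \<bullet> x) *\<^sub>R m + k *\<^sub>R x"
    by (fact rectifiable_bundle_quadratic[OF assms(2,3)])
  obtain \<beta> f where \<beta>: "linear \<beta>" and f: "sided_qmult f" and Qf: "\<And>x. Q x = f (\<beta> x) x"
    using isotropic_quadratic_is_quaternionic[OF Q] unfolding sided_qmult_def by metis
  define A :: "real^4 \<Rightarrow> real^4" where "A = (\<lambda>x. x)"
  define B where "B = (\<lambda>x. axis 1 1 - \<beta> x)"
  define T where "T = (\<lambda>x. f (qinv (B x)) (A x))"
  have "affine_map A"
    unfolding affine_map_def A_def by (rule exI[of _ "\<lambda>x. x"]) (auto intro: exI[of _ 0] linear_ident)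
  moreover have "affine_map B"
    unfolding affine_map_def B_def
    by (rule exI[of _ "\<lambda>x. - \<beta> x"]) (auto intro!: exI[of _ "axis 1 1"] linear_compose_neg[OF \<beta>])
  moreover have "T = (\<lambda>x. qmult (qinv (B x)) (A x)) \<or> T = (\<lambda>x. qmult (A x) (qinv (B x)))"
    using f by (auto simp: sided_qmult_def T_def)
  moreover have "T 0 = 0"
    by (simp add: T_def A_def bilinear_rzero[OF sided_qmult_bilinear[OF f]])
  moreover obtain U V g where UV: "0 \<in> U" "0 \<in> V" "diffeo_on U V T g"
    and g: "\<And>y z. y \<in> V \<Longrightarrow> z + f (\<beta> z) y = y \<Longrightarrow> g y = z"
    using sided_quotient_diffeo[OF f \<beta>] unfolding T_def A_def B_def by blast
  have "open V" using UV(3) by (simp add: diffeo_on_def)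
  then obtain e where e: "e > 0" "ball 0 e \<subseteq> V" using UV(2) open_contains_ball by blast
  have "\<exists>L \<epsilon>. is_line L \<and> \<epsilon> > 0 \<and> ball 0 \<epsilon> \<subseteq> V \<and> g ` (C \<inter> ball 0 \<epsilon>) \<subseteq> L" if C: "C \<in> S" for C
  proof -
    have "is_circle C" "0 \<in> C" using assms(1) C by (auto simp: simple_bundle_def)
    then obtain x m k where x: "x \<noteq> 0" and Cx: "\<And>p. p \<in> C \<Longrightarrow> \<exists>s. p = (p \<bullet> p) *\<^sub>R m + s *\<^sub>R x"
      and Qx: "Q x = (x \<bullet> x) *\<^sub>R m + k *\<^sub>R x"
      using QC[OF C] by blast
    \<comment> \<open>The second bound ensures |p| |\<beta> x| < |x|, the smallness needed to solve
      for t; the first keeps p in V.\<close>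
    define \<epsilon> where "\<epsilon> = min e (norm x / (norm (\<beta> x) + 1))"
    have \<epsilon>: "\<epsilon> > 0" "\<epsilon> \<le> e" "\<epsilon> * (norm (\<beta> x) + 1) \<le> norm x"
    proof -
      have n: "norm (\<beta> x) + 1 > 0" using norm_ge_zero[of "\<beta> x"] by linarith
      then show "\<epsilon> > 0" "\<epsilon> \<le> e" using e(1) x by (simp_all add: \<epsilon>_def)
      have "\<epsilon> \<le> norm x / (norm (\<beta> x) + 1)" by (simp add: \<epsilon>_def)
      then show "\<epsilon> * (norm (\<beta> x) + 1) \<le> norm x" using n by (simp add: pos_le_divide_eq)
    qed
    have "g p \<in> range (line_param 0 x)" if p: "p \<in> C" "norm p < \<epsilon>" for p
    proof -
      obtain s where s: "p = (p \<bullet> p) *\<^sub>R m + s *\<^sub>R x" using Cx[OF p(1)] by blast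
      have "norm p * norm (\<beta> x) \<le> \<epsilon> * norm (\<beta> x)"
        using p(2) by (intro mult_right_mono) auto
      also have "\<dots> < norm x" using \<epsilon> by (simp add: distrib_left)
      finally have "(norm p * norm (\<beta> x))\<^sup>2 < (norm x)\<^sup>2"
        by (intro power_strict_mono) auto
      then have small: "(p \<bullet> p) * (\<beta> x \<bullet> \<beta> x) < x \<bullet> x"
        by (simp add: power_mult_distrib power2_norm_eq_inner)
      obtain t where t: "t *\<^sub>R x + t *\<^sub>R f (\<beta> x) p = p"
        using sided_qmult_circle_solution[OF f x Qx[unfolded Qf] s small] by blast
      \<comment> \<open>By linearity of \<beta>, z = t x solves the equation that characterises g p,
        so the whole germ is sent into the line spanned by x.\<close>
      have "t *\<^sub>R x + f (\<beta> (t *\<^sub>R x)) p = p"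
        using t by (simp add: linear_cmul[OF \<beta>] bilinear_lmul[OF sided_qmult_bilinear[OF f]])
      moreover have "p \<in> V" using p(2) \<epsilon>(2) e(2) by (auto simp: subset_iff)
      ultimately have "g p = line_param 0 x t" using g by (simp add: line_param_def)
      then show ?thesis by blast
    qed
    then have "g ` (C \<inter> ball 0 \<epsilon>) \<subseteq> range (line_param 0 x)" by auto
    moreover have "is_line (range (line_param 0 x))" using x unfolding is_line_def by blast
    moreover have "ball 0 \<epsilon> \<subseteq> V" using e(2) \<epsilon>(2) by (auto simp: subset_iff)
    ultimately show ?thesis using \<epsilon>(1) by blast
  qed
  ultimately show ?thesis using UV(1,3) by blast
qed

end
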